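(* Let $m\ge 2$ and $d\ge 2$ be fixed integers. For $(\alpha,p)\in[0,1]^2$ define $$\psi(\alpha,p)=\frac{p}{2}\left(2-\alpha+\sqrt{(2-\alpha)^2-\frac{4(1-\alpha)\big((m-2)(2-\alpha)+\alpha d(m-1)\big)}{(d(m-1)+m-2)^2}}\right).$$ Then, for every $(\alpha,p)\in[0,1]^2$ such that $\psi(\alpha,p)<1$, the frog model $\mathrm{FM}(\mathbb{D}_{m,d},\alpha,p)$ dies out almost surely.
   Context: Graph. $\mathbb{D}_{m,d}$ is the free product of $d+1$ copies of the complete graph $\mathbb{K}_m$ on $m$ vertices, i.e. the Cayley graph of the free product $\mathbb{Z}_m*\cdots*\mathbb{Z}_m$ ($d+1$ factors) with respect to the generating set consisting of all non-identity elements of the factors; the same symbol denotes the vertex set. The identity element $\varnothing$ is the root. Every vertex has degree $\Delta=(d+1)(m-1)$ and there is a unique geodesic between any two vertices. For a vertex $u\ne\varnothing$, its parent $u^-$ is the neighbor of $u$ on the geodesic from $u$ to $\varnothing$; its children are the $d(m-1)$ neighbors at distance $\mathrm{dist}(\varnothing,u)+1$ from the root; its siblings are the $m-2$ neighbors at distance $\mathrm{dist}(\varnothing,u)$ from the root. All $\Delta$ neighbors of the root are children of the root. Walk. The $\alpha$-biased random walk on $\mathbb{D}_{m,d}$ is the Markov chain which, from $u\neq\varnothing$, moves to $u^-$ with probability $\alpha$ and to each of the other $\Delta-1$ neighbors with probability $\frac{1-\alpha}{\Delta-1}$; from the root it stays at the root with probability $\alpha$ and jumps to a uniformly chosen child with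 probability $1-\alpha$. Frog model $\mathrm{FM}(\mathbb{D}_{m,d},\alpha,p)$. Initially there is one active particle at the root and one sleeping particle at each other vertex. Each vertex $u$ carries an independent $\alpha$-biased random walk $(S_n^u)_{n\ge0}$ started at $u$ and an independent lifetime $\Xi_p^u$ with $\mathbb{P}(\Xi_p^u>n)=p^n$, $n\ge 0$ (geometric with parameter $1-p$; infinite if $p=1$). Once activated, the particle of $u$ follows its walk, visiting the sites $S_n^u$, $0\le n<\Xi_p^u$, and then disappears (equivalently, at each time step an active particle dies with probability $1-p$ and otherwise makes one step). When an active particle visits a vertex containing a sleeping particle, the latter becomes active. The process survives if at every time there is at least one active particle; otherwise it dies out. *)

theory Defs
  imports
    "HOL-Algebra.Elementary_Groups"
    "HOL-Probability.Probability"
begin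

section \<open>Free products of groups and the graph\<close>

text \<open>The free product of the groups \<open>G i\<close>, \<open>i \<in> I\<close>, in normal form: reduced words, whose letters
  \<open>(i, g)\<close> are non-identity elements \<open>g\<close> of the factor \<open>i\<close>, adjacent letters coming from different
  factors. The list \<open>[s\<^sub>1, \<dots>, s\<^sub>k]\<close> stands for the product \<open>s\<^sub>1 \<cdots> s\<^sub>k\<close>.\<close>

definition letters :: "'i set \<Rightarrow> ('i \<Rightarrow> ('a, 'b) monoid_scheme) \<Rightarrow> ('i \<times> 'a) set" where
  "letters I G = {(i, g). i \<in> I \<and> g \<in> carrier (G i) \<and> g \<noteq> \<one>\<^bsub>G i\<^esub>}"

definition reduced_words :: "'i set \<Rightarrow> ('i \<Rightarrow> ('a, 'b) monoid_scheme) \<Rightarrow> ('i \<times> 'a) list set" where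
  "reduced_words I G = {w. set w \<subseteq> letters I G \<and> distinct_adj (map fst w)}"

text \<open>Left multiplication of a reduced word by a single letter.\<close>

fun letter_mult :: "('i \<Rightarrow> ('a, 'b) monoid_scheme) \<Rightarrow> 'i \<times> 'a \<Rightarrow> ('i \<times> 'a) list \<Rightarrow> ('i \<times> 'a) list" where
  "letter_mult G (i, g) [] = [(i, g)]"
| "letter_mult G (i, g) ((j, h) # w) =
     (if i \<noteq> j then (i, g) # (j, h) # w
      else if g \<otimes>\<^bsub>G i\<^esub> h = \<one>\<^bsub>G i\<^esub> then w
      else (i, g \<otimes>\<^bsub>G i\<^esub> h) # w)"

definition free_product :: "'i set \<Rightarrow> ('i \<Rightarrow> ('a, 'b) monoid_scheme) \<Rightarrow> ('i \<times> 'a) list monoid" where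
  "free_product I G =
     \<lparr>carrier = reduced_words I G, monoid.mult = (\<lambda>u v. foldr (letter_mult G) u v), one = []\<rparr>"

lemma reduced_words_Nil [simp]: "[] \<in> reduced_words I G"
  by (simp add: reduced_words_def)

lemma reduced_words_Cons:
  "(i, g) # w \<in> reduced_words I G \<longleftrightarrow>
     (i, g) \<in> letters I G \<and> w \<in> reduced_words I G \<and> (w = [] \<or> fst (hd w) \<noteq> i)"
  by (cases w) (auto simp: reduced_words_def)

lemma letter_mult_closed:
  assumes G: "\<And>i. i \<in> I \<Longrightarrow> group (G i)"
    and s: "(i, g) \<in> letters I G" and w: "w \<in> reduced_words I G"
  shows "letter_mult G (i, g) w \<in> reduced_words I G"
proof (cases w)
  case Nil
  with s show ?thesis by (simp add: reduced_words_Cons)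
next
  case (Cons t w')
  obtain j h where t: "t = (j, h)" by (cases t)
  interpret group "G i" using G s by (simp add: letters_def)
  show ?thesis
    using s w unfolding Cons t by (auto simp: reduced_words_Cons) (auto simp: letters_def intro: group.is_monoid G monoid.m_closed)
qed

lemma letter_mult_letter_mult:
  assumes G: "\<And>i. i \<in> I \<Longrightarrow> group (G i)"
    and g: "(i, g) \<in> letters I G" and h: "(i, h) \<in> letters I G" and w: "w \<in> reduced_words I G"
  shows "letter_mult G (i, g) (letter_mult G (i, h) w) =
    (if g \<otimes>\<^bsub>G i\<^esub> h = \<one>\<^bsub>G i\<^esub> then w else letter_mult G (i, g \<otimes>\<^bsub>G i\<^esub> h) w)"
proof -
  interpret group "G i" using G g by (simp add: letters_def)
  have gc: "g \<in> carrier (G i)" "g \<noteq> \<one>\<^bsub>G i\<^esub>" and hc: "h \<in> carrier (G i)" "h \<noteq> \<one>\<^bsub>G i\<^esub>"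
    using g h by (auto simp: letters_def)
  show ?thesis
  proof (cases "w = [] \<or> fst (hd w) \<noteq> i")
    case True
    then show ?thesis by (cases w) auto
  next
    case False
    then obtain k w' where w_eq: "w = (i, k) # w'"
      by (metis list.exhaust_sel prod.collapse)
    with w have kc: "k \<in> carrier (G i)" "k \<noteq> \<one>\<^bsub>G i\<^esub>" and w': "w' = [] \<or> fst (hd w') \<noteq> i"
      by (auto simp: reduced_words_Cons letters_def)
    have ass: "g \<otimes>\<^bsub>G i\<^esub> (h \<otimes>\<^bsub>G i\<^esub> k) = (g \<otimes>\<^bsub>G i\<^esub> h) \<otimes>\<^bsub>G i\<^esub> k"
      using gc hc kc by (simp add: m_assoc)
    show ?thesis
    proof (cases "h \<otimes>\<^bsub>G i\<^esub> k = \<one>\<^bsub>G i\<^esub>")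
      case True
      then have "(g \<otimes>\<^bsub>G i\<^esub> h) \<otimes>\<^bsub>G i\<^esub> k = g" using ass gc by simp
      moreover have "g = k" if "g \<otimes>\<^bsub>G i\<^esub> h = \<one>\<^bsub>G i\<^esub>"
        using that calculation kc by simp
      ultimately show ?thesis using True w' gc kc unfolding w_eq by (cases w') auto
    next
      case False
      have "k = h \<otimes>\<^bsub>G i\<^esub> k \<Longrightarrow> False"
        using hc kc by (metis r_cancel_one')
      then show ?thesis using False ass gc hc kc unfolding w_eq by auto
    qed
  qed
qed

lemma group_free_product:
  assumes G: "\<And>i. i \<in> I \<Longrightarrow> group (G i)"
  shows "group (free_product I G)"
proof -
  let ?m = "foldr (letter_mult G)"
  let ?W = "reduced_words I G"
  have closed: "?m u v \<in> ?W" if "u \<in> ?W" "v \<in> ?W" for u v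
    using that
  proof (induction u)
    case (Cons s u)
    then show ?case
      by (cases s) (auto simp: reduced_words_Cons intro!: letter_mult_closed[OF G])
  qed simp
  have step: "?m (letter_mult G (i, g) x) w = letter_mult G (i, g) (?m x w)"
    if s: "(i, g) \<in> letters I G" and x: "x \<in> ?W" and w: "w \<in> ?W" for i g x w
  proof (cases "x = [] \<or> fst (hd x) \<noteq> i")
    case True
    then show ?thesis by (cases x) auto
  next
    case False
    then obtain h x' where x_eq: "x = (i, h) # x'"
      by (metis list.exhaust_sel prod.collapse)
    with x have "(i, h) \<in> letters I G" "x' \<in> ?W"
      by (auto simp: reduced_words_Cons)
    then show ?thesis
      using letter_mult_letter_mult[OF G s, of h "?m x' w"] closed[of x' w] w
      by (auto simp: x_eq)
  qed
  have assoc: "?m (?m u v) w = ?m u (?m v w)" if "u \<in> ?W" "v \<in> ?W" "w \<in> ?W" for u v w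
    using that
  proof (induction u)
    case (Cons s u)
    obtain i g where s: "s = (i, g)" by (cases s)
    from Cons show ?case
      by (auto simp: s reduced_words_Cons step closed)
  qed simp
  have inv: "\<exists>v\<in>?W. ?m v u = []" if "u \<in> ?W" for u
    using that
  proof (induction u)
    case (Cons s u)
    obtain i g where s: "s = (i, g)" by (cases s)
    with Cons obtain v where v: "v \<in> ?W" "?m v u = []" and u: "u \<in> ?W"
      and ig: "(i, g) \<in> letters I G"
      by (auto simp: reduced_words_Cons)
    interpret group "G i" using G ig by (simp add: letters_def)
    let ?t = "[(i, inv\<^bsub>G i\<^esub> g)]"
    have t: "?t \<in> ?W" using ig by (auto simp: reduced_words_Cons letters_def)
    have "?m ?t (s # u) = u" using ig by (simp add: s letters_def)
    then have "?m (?m v ?t) (s # u) = []"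
      using assoc[OF v(1) t Cons.prems] v by simp
    then show ?case using closed[OF v(1) t] by blast
  qed (auto intro!: bexI[of _ "[]"])
  show ?thesis
    by (rule groupI) (auto simp: free_product_def closed assoc inv)
qed

type_synonym vertex = "(nat \<times> int) list"

definition D_group :: "nat \<Rightarrow> nat \<Rightarrow> vertex monoid" where
  "D_group m d = free_product {..d} (\<lambda>_. integer_mod_group m)"

definition D_gens :: "nat \<Rightarrow> nat \<Rightarrow> vertex set" where
  "D_gens m d = {[s] | s. s \<in> letters {..d} (\<lambda>_. integer_mod_group m)}"

definition cayley_edges :: "('a, 'b) monoid_scheme \<Rightarrow> 'a set \<Rightarrow> ('a \<times> 'a) set" where
  "cayley_edges G A = {(u, u \<otimes>\<^bsub>G\<^esub> s) | u s. u \<in> carrier G \<and> s \<in> A}"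

definition D_verts :: "nat \<Rightarrow> nat \<Rightarrow> vertex set" where
  "D_verts m d = carrier (D_group m d)"

definition D_edges :: "nat \<Rightarrow> nat \<Rightarrow> (vertex \<times> vertex) set" where
  "D_edges m d = cayley_edges (D_group m d) (D_gens m d)"

definition D_root :: vertex where
  "D_root = []"

definition D_degree :: "nat \<Rightarrow> nat \<Rightarrow> nat" where
  "D_degree m d = (d + 1) * (m - 1)"

definition graph_dist :: "('a \<times> 'a) set \<Rightarrow> 'a \<Rightarrow> 'a \<Rightarrow> nat" where
  "graph_dist E u v = (LEAST n. (u, v) \<in> E ^^ n)"

definition geodesic :: "('a \<times> 'a) set \<Rightarrow> 'a \<Rightarrow> 'a list \<Rightarrow> 'a \<Rightarrow> bool" where
  "geodesic E u xs v \<longleftrightarrow> xs \<noteq> [] \<and> hd xs = u \<and> last xs = v \<and>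
     successively (\<lambda>x y. (x, y) \<in> E) xs \<and> length xs = Suc (graph_dist E u v)"

definition parent :: "nat \<Rightarrow> nat \<Rightarrow> vertex \<Rightarrow> vertex" where
  "parent m d u = (THE v. (u, v) \<in> D_edges m d \<and>
     (\<exists>xs. geodesic (D_edges m d) u xs D_root \<and> v \<in> set xs))"

definition children :: "nat \<Rightarrow> nat \<Rightarrow> vertex \<Rightarrow> vertex set" where
  "children m d u = {v. (u, v) \<in> D_edges m d \<and>
     graph_dist (D_edges m d) D_root v = graph_dist (D_edges m d) D_root u + 1}"


section \<open>The biased walk and the frog model\<close>

definition walk_kernel :: "nat \<Rightarrow> nat \<Rightarrow> real \<Rightarrow> vertex \<Rightarrow> vertex \<Rightarrow> real" where
  "walk_kernel m d \<alpha> u v =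
     (if u = D_root then
        (if v = D_root then \<alpha>
         else if v \<in> children m d D_root then (1 - \<alpha>) / real (card (children m d D_root))
         else 0)
      else
        (if v = parent m d u then \<alpha>
         else if (u, v) \<in> D_edges m d then (1 - \<alpha>) / (real (D_degree m d) - 1)
         else 0))"

definition markov_chain ::
  "'w measure \<Rightarrow> ('v \<Rightarrow> 'v \<Rightarrow> real) \<Rightarrow> 'v \<Rightarrow> (nat \<Rightarrow> 'w \<Rightarrow> 'v) \<Rightarrow> bool" where
  "markov_chain M K u X \<longleftrightarrow>
     (\<forall>n. X n \<in> measurable M (count_space UNIV)) \<and>
     (AE \<omega> in M. X 0 \<omega> = u) \<and>
     (\<forall>n x y. \<P>(\<omega> in M. \<forall>i\<le>n. X i \<omega> = x i) > 0 \<longrightarrow>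
        \<P>(\<omega> in M. X (Suc n) \<omega> = y \<bar> \<forall>i\<le>n. X i \<omega> = x i) = K (x n) y)"

text \<open>The randomness of the model: \<open>S u n\<close> is the position after \<open>n\<close> steps of the walk of the
  particle initially at \<open>u\<close>, and \<open>\<Xi> u\<close> is its lifetime. All walks and all lifetimes are mutually
  independent; as they take values in different spaces, this is independence of the generated
  \<open>\<sigma>\<close>-algebras, indexed by the disjoint sum of two copies of the vertex set.\<close>

locale frog_model = prob_space M
  for M :: "'w measure" +
  fixes m d :: nat and \<alpha> p :: real
    and S :: "vertex \<Rightarrow> nat \<Rightarrow> 'w \<Rightarrow> vertex"
    and \<Xi> :: "vertex \<Rightarrow> 'w \<Rightarrow> enat"
  assumes walk: "u \<in> D_verts m d \<Longrightarrow> markov_chain M (walk_kernel m d \<alpha>) u (S u)"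
    and lifetime_measurable: "u \<in> D_verts m d \<Longrightarrow> \<Xi> u \<in> measurable M (count_space UNIV)"
    and lifetime: "u \<in> D_verts m d \<Longrightarrow> \<P>(\<omega> in M. \<Xi> u \<omega> > enat n) = p ^ n"
    and independent:
      "indep_sets
         (\<lambda>k. case k of
            Inl u \<Rightarrow> {(\<lambda>\<omega> n. S u n \<omega>) -` A \<inter> space M | A. A \<in> sets (PiM UNIV (\<lambda>_. count_space UNIV))}
          | Inr u \<Rightarrow> {\<Xi> u -` B \<inter> space M | B. B \<in> sets (count_space UNIV)})
         (D_verts m d <+> D_verts m d)"

text \<open>The deterministic dynamics, for given trajectories \<open>s\<close> and lifetimes \<open>l\<close>.
  \<open>woken V s l t u = Some k\<close> means that the particle of \<open>u\<close> has been activated by time \<open>t\<close>, namely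
  at time \<open>k \<le> t\<close>; from then on it is at \<open>s u n\<close> at time \<open>k + n\<close>, as long as \<open>n < l u\<close>.\<close>

primrec woken :: "vertex set \<Rightarrow> (vertex \<Rightarrow> nat \<Rightarrow> vertex) \<Rightarrow> (vertex \<Rightarrow> enat) \<Rightarrow>
    nat \<Rightarrow> vertex \<Rightarrow> nat option" where
  "woken V s l 0 = [D_root \<mapsto> 0]"
| "woken V s l (Suc t) = (\<lambda>v.
     case woken V s l t v of
       Some k \<Rightarrow> Some k
     | None \<Rightarrow>
         if v \<in> V \<and> (\<exists>u k. woken V s l t u = Some k \<and>
                        enat (Suc t - k) < l u \<and> s u (Suc t - k) = v)
         then Some (Suc t) else None)"

definition active_at :: "vertex set \<Rightarrow> (vertex \<Rightarrow> nat \<Rightarrow> vertex) \<Rightarrow> (vertex \<Rightarrow> enat) \<Rightarrow>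
    nat \<Rightarrow> vertex set" where
  "active_at V s l t = {u. \<exists>k. woken V s l t u = Some k \<and> enat (t - k) < l u}"

definition survives :: "vertex set \<Rightarrow> (vertex \<Rightarrow> nat \<Rightarrow> vertex) \<Rightarrow> (vertex \<Rightarrow> enat) \<Rightarrow> bool" where
  "survives V s l \<longleftrightarrow> (\<forall>t. active_at V s l t \<noteq> {})"

definition dies_out :: "vertex set \<Rightarrow> (vertex \<Rightarrow> nat \<Rightarrow> vertex) \<Rightarrow> (vertex \<Rightarrow> enat) \<Rightarrow> bool" where
  "dies_out V s l \<longleftrightarrow> \<not> survives V s l"

definition psi :: "nat \<Rightarrow> nat \<Rightarrow> real \<Rightarrow> real \<Rightarrow> real" where
  "psi m d \<alpha> p = p / 2 * (2 - \<alpha> + sqrt ((2 - \<alpha>)\<^sup>2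
     - 4 * (1 - \<alpha>) * ((real m - 2) * (2 - \<alpha>) + \<alpha> * real d * (real m - 1))
       / (real d * (real m - 1) + real m - 2)\<^sup>2))"

end

theory Submission
  imports Defs
begin

text \<open>If the process is alive at time \<open>t\<close>, one can follow, backwards in time, an active frog, the
  frog that woke it up, and so on to the root. This yields a path of length \<open>t\<close> from the root whose
  steps are distributed among distinct frogs, and each frog starts at a site that the path has not
  visited before. By independence the probability of such a chain is the product of its
  transition probabilities times \<open>p ^ t\<close>, and the expected number of chains is estimated by a
  linear recursion: every step either keeps the frog or, at a fresh site, passes to the frog
  sleeping there. Moves to the parent, and immediate returns to a child or a sibling, never lead to
  a fresh site. Choosing among several possible activators the one that woke up first gains a further
  factor at consecutive handovers. An explicit supersolution of the recursion shows that
  the expected number of chains decays exponentially in \<open>t\<close> as soon as \<open>psi < 1\<close>.\<close>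

section \<open>The graph in terms of reduced words\<close>

text \<open>Freshness of a site depends on the whole past, but the estimate relies on only two sites
  being visited, the parent and the predecessor of the current position; all other neighbours count
  as fresh. Away from the root this leaves a recursion with finitely many types of last step. Let
  \<open>\<tau>\<close> be the weight of a surviving step to one given child or sibling, and
  \<open>\<beta>\<close> the number of siblings. When its roots are real, the quadratic
  \<open>x\<^sup>2 - p * (2 - \<alpha>) * x + \<tau> * (2 * \<beta> * \<tau> + \<alpha> * p)\<close>
  has \<open>psi\<close> as its larger root, and \<open>psi < 1\<close> enters only through the
  positivity of this quadratic at 1. Read as a one-step sum, that positivity gives weight 1 to a
  step to a child, once with and once without a handover, and weight \<open>1 - \<tau>\<close> to
  steps to a sibling or to the parent, after which one fresh neighbour is lost.\<close>

lemma letters_integer_mod_group: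
  assumes "m \<ge> 2"
  shows "letters I (\<lambda>_. integer_mod_group m) = I \<times> {1..<int m}"
  using assms by (auto simp: letters_def carrier_integer_mod_group)

lemma D_verts_iff:
  assumes "m \<ge> 2"
  shows "w \<in> D_verts m d \<longleftrightarrow> set w \<subseteq> {..d} \<times> {1..<int m} \<and> distinct_adj (map fst w)"
  using assms
  by (simp add: D_verts_def D_group_def free_product_def reduced_words_def letters_integer_mod_group)

lemma foldr_letter_mult_append:
  assumes "distinct_adj (map fst (u @ v))"
  shows "foldr (letter_mult G) u v = u @ v"
  using assms
proof (induction u)
  case (Cons s u)
  obtain i g where s: "s = (i, g)" by (cases s)
  have IH: "foldr (letter_mult G) u v = u @ v"
    using Cons by (auto simp: distinct_adj_Cons)
  show ?case
    using Cons.prems by (cases "u @ v") (auto simp: s IH simp del: append_is_Nil_conv)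
qed simp

text \<open>A right factor from the same group as the last letter merges with it; any other is
  appended. The rest of the word is already reduced, so refolding it is plain concatenation. The
  outcomes are a child, the parent and a sibling.\<close>

lemma foldr_letter_mult_snoc:
  assumes "distinct_adj (map fst (u @ [(i, g)]))"
  shows "foldr (letter_mult G) (u @ [(i, g)]) [(j, h)] =
    (if i \<noteq> j then u @ [(i, g), (j, h)]
     else if g \<otimes>\<^bsub>G i\<^esub> h = \<one>\<^bsub>G i\<^esub> then u
     else u @ [(i, g \<otimes>\<^bsub>G i\<^esub> h)])"
proof -
  have "distinct_adj (map fst (u @ [(i, x), (j, h)]))" if "i \<noteq> j" for x
    using assms that by (auto simp: distinct_adj_append_iff)
  moreover have "distinct_adj (map fst (u @ [(i, x)]))" for x
    using assms by (auto simp: distinct_adj_append_iff)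
  moreover have "distinct_adj (map fst u)"
    using assms by (auto simp: distinct_adj_append_iff)
  ultimately show ?thesis
    using foldr_letter_mult_append[of u "[]" G]
      foldr_letter_mult_append[of u "[(i, g), (j, h)]" G]
      foldr_letter_mult_append[of u "[(i, g \<otimes>\<^bsub>G i\<^esub> h)]" G]
    by auto
qed

definition level1 :: "nat \<Rightarrow> nat \<Rightarrow> vertex set" where
  "level1 m d = (\<lambda>s. [s]) ` ({..d} \<times> {1..<int m})"

definition kids :: "nat \<Rightarrow> nat \<Rightarrow> vertex \<Rightarrow> vertex set" where
  "kids m d u = (\<lambda>s. u @ [s]) ` (({..d} - {fst (last u)}) \<times> {1..<int m})"

definition sibs :: "nat \<Rightarrow> vertex \<Rightarrow> vertex set" where
  "sibs m u = (\<lambda>h. butlast u @ [(fst (last u), h)]) ` ({1..<int m} - {snd (last u)})"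

text \<open>The root is listed among its own neighbours because the walk may hold there: this is the
  range of one step of the walk, not graph adjacency.\<close>

definition nbrs :: "nat \<Rightarrow> nat \<Rightarrow> vertex \<Rightarrow> vertex set" where
  "nbrs m d u = (if u = [] then insert [] (level1 m d)
     else insert (butlast u) (kids m d u \<union> sibs m u))"

lemma finite_nbrs [simp]: "finite (level1 m d)" "finite (kids m d u)" "finite (sibs m u)"
  "finite (nbrs m d u)"
  by (auto simp: level1_def kids_def sibs_def nbrs_def)

lemma level1_subset: "m \<ge> 2 \<Longrightarrow> level1 m d \<subseteq> D_verts m d"
  by (auto simp: level1_def D_verts_iff)

lemma D_verts_butlast: "m \<ge> 2 \<Longrightarrow> u \<in> D_verts m d \<Longrightarrow> butlast u \<in> D_verts m d"
  by (cases u rule: rev_cases) (auto simp: D_verts_iff distinct_adj_append_iff)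

lemma nbrs_subset:
  assumes "m \<ge> 2" "u \<in> D_verts m d"
  shows "nbrs m d u \<subseteq> D_verts m d"
proof (cases u rule: rev_cases)
  case Nil
  then show ?thesis
    using level1_subset[OF assms(1)] assms by (auto simp: nbrs_def)
next
  case (snoc w s)
  have "kids m d u \<subseteq> D_verts m d" "sibs m u \<subseteq> D_verts m d"
    using assms by (auto simp: kids_def sibs_def snoc D_verts_iff distinct_adj_append_iff)
  then show ?thesis
    using D_verts_butlast[OF assms] snoc by (auto simp: nbrs_def)
qed

lemma card_kids:
  assumes "m \<ge> 2" "u \<in> D_verts m d" "u \<noteq> []"
  shows "real (card (kids m d u)) = real d * (real m - 1)"
proof -
  have "fst (last u) \<in> {..d}"
    using assms by (cases u rule: rev_cases) (auto simp: D_verts_iff)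
  then have "card ({..d} - {fst (last u)}) = d" by simp
  then have "card (kids m d u) = d * (m - 1)"
    by (simp add: kids_def card_image inj_on_def nat_diff_distrib' card_cartesian_product)
  then show ?thesis using assms by (simp add: of_nat_diff)
qed

lemma card_sibs:
  assumes "m \<ge> 2" "u \<in> D_verts m d" "u \<noteq> []"
  shows "real (card (sibs m u)) = real m - 2"
proof -
  have "snd (last u) \<in> {1..<int m}"
    using assms by (cases u rule: rev_cases) (auto simp: D_verts_iff)
  then have "card ({1..<int m} - {snd (last u)}) = m - 2"
    by (simp add: nat_diff_distrib')
  then have "card (sibs m u) = m - 2"
    by (simp add: sibs_def card_image inj_on_def)
  then show ?thesis using assms by (simp add: of_nat_diff)
qed

lemma D_edges_iff:
  assumes "m \<ge> 2"
  shows "(u, v) \<in> D_edges m d \<longleftrightarrow> u \<in> D_verts m d \<and>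
    (if u = [] then v \<in> level1 m d else v \<in> nbrs m d u)"
proof -
  let ?G = "\<lambda>_. integer_mod_group m"
  have *: "(u, v) \<in> D_edges m d \<longleftrightarrow> u \<in> D_verts m d \<and>
    (\<exists>j\<le>d. \<exists>h\<in>{1..<int m}. v = foldr (letter_mult ?G) u [(j, h)])"
    by (auto simp: D_edges_def cayley_edges_def D_gens_def letters_integer_mod_group[OF assms]
        D_verts_def D_group_def free_product_def Bex_def)
  show ?thesis
  proof (cases u rule: rev_cases)
    case Nil
    then show ?thesis unfolding * by (auto simp: level1_def)
  next
    case (snoc w s)
    obtain i g where s: "s = (i, g)" by (cases s)
    have "v \<in> nbrs m d u \<longleftrightarrow> (\<exists>j\<le>d. \<exists>h\<in>{1..<int m}. v = foldr (letter_mult ?G) u [(j, h)])"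
      if u: "u \<in> D_verts m d"
    proof -
      have adj: "distinct_adj (map fst (w @ [(i, g)]))" and i: "i \<le> d" and g: "g \<in> {1..<int m}"
        using u assms by (auto simp: D_verts_iff snoc s)
      note mult' = foldr_letter_mult_snoc[OF adj, where G = ?G, folded s, folded snoc]
      have mult: "foldr (letter_mult ?G) u [(j, h)] = u @ [(j, h)]" if "i \<noteq> j" for j h
        unfolding mult' using that snoc s by simp
      have mult0: "foldr (letter_mult ?G) u [(i, h)] = w" if "(g + h) mod int m = 0" for h
        unfolding mult' using that by simp
      have mult1: "foldr (letter_mult ?G) u [(i, h)] = w @ [(i, (g + h) mod int m)]"
        if "(g + h) mod int m \<noteq> 0" for h
        unfolding mult' using that by simp
      show ?thesis
      proof
        assume "v \<in> nbrs m d u"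
        then have "v = w \<or> (\<exists>j h. j \<le> d \<and> j \<noteq> i \<and> h \<in> {1..<int m} \<and> v = u @ [(j, h)]) \<or>
            (\<exists>h. h \<in> {1..<int m} \<and> h \<noteq> g \<and> v = w @ [(i, h)])"
          by (auto simp: nbrs_def kids_def sibs_def snoc s)
        then consider "v = w" | j h where "j \<le> d" "j \<noteq> i" "h \<in> {1..<int m}" "v = u @ [(j, h)]"
          | h where "h \<in> {1..<int m}" "h \<noteq> g" "v = w @ [(i, h)]"
          by blast
        then show "\<exists>j\<le>d. \<exists>h\<in>{1..<int m}. v = foldr (letter_mult ?G) u [(j, h)]"
        proof cases
          case 1
          have "int m - g \<in> {1..<int m}" using g by auto
          then show ?thesis using 1 i
            by (intro exI[of _ i] conjI bexI[of _ "int m - g"]) (simp_all add: mult')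
        next
          case 2
          then show ?thesis
            by (intro exI[of _ j] conjI bexI[of _ h] mult[symmetric, THEN trans[rotated]]) auto
        next
          case (3 h)
          have "(h - g) mod int m \<in> {1..<int m}"
          proof -
            have "(h - g) mod int m \<noteq> 0"
            proof
              assume "(h - g) mod int m = 0"
              then have "h mod int m = g mod int m" by (simp add: mod_eq_dvd_iff dvd_eq_mod_eq_0)
              then show False using 3 g by simp
            qed
            then show ?thesis using assms
              by (smt (verit) atLeastLessThan_iff of_nat_le_0_iff pos_mod_bound pos_mod_sign not_numeral_le_zero int_nat_eq nat_int)
          qed
          moreover have "(g + (h - g) mod int m) mod int m = h"
            using 3 by (simp add: mod_add_right_eq)
          ultimately show ?thesis using 3 i
            by (intro exI[of _ i] conjI bexI[of _ "(h - g) mod int m"])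
               (simp_all add: mult')
        qed
      next
        assume "\<exists>j\<le>d. \<exists>h\<in>{1..<int m}. v = foldr (letter_mult ?G) u [(j, h)]"
        then obtain j h where jh: "j \<le> d" "h \<in> {1..<int m}"
          and v: "v = foldr (letter_mult ?G) u [(j, h)]" by blast
        consider "i \<noteq> j" | "i = j" "(g + h) mod int m = 0" | "i = j" "(g + h) mod int m \<noteq> 0" by blast
        then show "v \<in> nbrs m d u"
        proof cases
          case 1
          then show ?thesis using jh v snoc s mult[OF 1] by (auto simp: nbrs_def kids_def)
        next
          case 2
          then show ?thesis using v mult0 snoc by (simp add: nbrs_def)
        next
          case 3
          have "(g + h) mod int m < int m" "(g + h) mod int m \<ge> 0" using assms by auto
          then have r: "(g + h) mod int m \<in> {1..<int m}" using 3 by auto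
          have "(g + h) mod int m \<noteq> g"
          proof
            assume "(g + h) mod int m = g"
            then have "(g + h) mod int m = (g + 0) mod int m" using g by simp
            then have "int m dvd h" by (simp add: mod_eq_dvd_iff)
            then show False using jh by (auto dest: zdvd_imp_le)
          qed
          then have "v \<in> sibs m u" using 3 v r mult1 snoc s by (auto simp: sibs_def)
          then show ?thesis using snoc by (simp add: nbrs_def)
        qed
      qed
    qed
    then show ?thesis unfolding * using snoc by auto
  qed
qed

lemma length_kids: "v \<in> kids m d u \<Longrightarrow> length v = Suc (length u)"
  by (auto simp: kids_def)

lemma length_sibs: "u \<noteq> [] \<Longrightarrow> v \<in> sibs m u \<Longrightarrow> length v = length u"
  by (cases u rule: rev_cases) (auto simp: sibs_def)

lemma sibs_neq: "u \<noteq> [] \<Longrightarrow> v \<in> sibs m u \<Longrightarrow> v \<noteq> u"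
  by (cases u rule: rev_cases) (auto simp: sibs_def)

lemma D_edges_length:
  assumes "m \<ge> 2" "(u, v) \<in> D_edges m d"
  shows "length u \<le> Suc (length v)"
proof (cases "u = []")
  case False
  then show ?thesis using assms length_kids length_sibs
    by (fastforce simp: D_edges_iff nbrs_def)
qed simp

lemma D_edges_butlast:
  assumes "m \<ge> 2" "(u, v) \<in> D_edges m d" "length u = Suc (length v)"
  shows "v = butlast u"
proof -
  have "u \<noteq> []" using assms by auto
  then show ?thesis using assms length_kids length_sibs
    by (fastforce simp: D_edges_iff nbrs_def)
qed

lemma D_edges_irrefl:
  assumes "m \<ge> 2" "(u, v) \<in> D_edges m d"
  shows "u \<noteq> v"
proof (cases "u = []")
  case True
  then show ?thesis using assms by (auto simp: D_edges_iff level1_def)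
next
  case False
  then have "butlast u \<noteq> u" by (metis append_butlast_last_id not_Cons_self2 append_self_conv)
  then show ?thesis using False assms length_kids[of u m d u] sibs_neq[of u u m]
    by (auto simp: D_edges_iff nbrs_def)
qed

section \<open>Distances to the root, geodesics and parents\<close>

lemma graph_dist_root:
  assumes "m \<ge> 2" "u \<in> D_verts m d"
  shows "graph_dist (D_edges m d) u D_root = length u"
  unfolding graph_dist_def
proof (rule Least_equality)
  show "(u, D_root) \<in> D_edges m d ^^ length u"
    using assms(2)
  proof (induction "length u" arbitrary: u)
    case (Suc n)
    then have "u \<noteq> []" by auto
    then have "(u, butlast u) \<in> D_edges m d"
      using Suc.prems assms(1) by (simp add: D_edges_iff nbrs_def)
    moreover have "(butlast u, D_root) \<in> D_edges m d ^^ n"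
      using Suc.hyps(1)[of "butlast u"] Suc.hyps(2)[symmetric] D_verts_butlast[OF assms(1) Suc.prems]
      by simp
    ultimately show ?case unfolding Suc.hyps(2)[symmetric] by (rule relpow_Suc_I2)
  qed (simp add: D_root_def)
next
  show "length u \<le> n" if "(u, D_root) \<in> D_edges m d ^^ n" for n
    using that
  proof (induction n arbitrary: u)
    case (Suc n)
    obtain v where "(u, v) \<in> D_edges m d" "(v, D_root) \<in> D_edges m d ^^ n"
      using Suc.prems by (blast dest: relpow_Suc_D2)
    then show ?case
      using Suc.IH D_edges_length[OF assms(1)] by fastforce
  qed (simp add: D_root_def)
qed

text \<open>An edge shortens a word by at most one letter, so a path of \<open>length u\<close>
  steps from \<open>u\<close> to the empty word must shorten it at every step; \<open>up\<close> and
  \<open>down\<close> count from its two ends.\<close>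

lemma length_geodesic_nth:
  assumes "m \<ge> 2" "u \<in> D_verts m d" "geodesic (D_edges m d) u xs D_root" "i < length xs"
  shows "length (xs ! i) = length u - i"
proof -
  let ?E = "D_edges m d"
  have len: "length xs = Suc (length u)"
    using assms graph_dist_root by (simp add: geodesic_def)
  have xs: "xs \<noteq> []" "xs ! 0 = u" "xs ! length u = D_root"
    using assms(3) len by (auto simp: geodesic_def hd_conv_nth last_conv_nth)
  have step: "(xs ! j, xs ! Suc j) \<in> ?E" if "j < length u" for j
    using assms(3) that len by (auto simp: geodesic_def successively_conv_nth)
  have up: "length u \<le> length (xs ! j) + j" if "j \<le> length u" for j
    using that
  proof (induction j)
    case (Suc j)
    then show ?case using D_edges_length[OF assms(1) step[of j]] by simp
  qed (simp add: xs)
  have down: "length (xs ! (length u - j)) \<le> j" if "j \<le> length u" for j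
    using that
  proof (induction j)
    case (Suc j)
    then have lt: "length u - Suc j < length u" by simp
    show ?case using Suc D_edges_length[OF assms(1) step[OF lt]]
      by (simp add: Suc_diff_Suc Suc_le_eq)
  qed (simp add: xs D_root_def)
  show ?thesis
    using up[of i] down[of "length u - i"] assms(4) len by simp
qed

text \<open>The prefixes of \<open>u\<close> form a geodesic, so \<open>butlast u\<close> qualifies.
  Conversely a neighbour on a geodesic is one letter shorter, and deleting the last letter is the
  only such edge.\<close>

lemma parent_eq_butlast:
  assumes "m \<ge> 2" "u \<in> D_verts m d" "u \<noteq> []"
  shows "parent m d u = butlast u"
  unfolding parent_def
proof (rule the_equality)
  let ?E = "D_edges m d" and ?xs = "map (\<lambda>i. take (length u - i) u) [0..<Suc (length u)]"
  have edge: "(u, butlast u) \<in> ?E" if "u \<in> D_verts m d" "u \<noteq> []" for u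
    using assms(1) that by (simp add: D_edges_iff nbrs_def)
  have take: "take k u \<in> D_verts m d" if "k \<le> length u" for k
    using that
  proof (induction "length u - k" arbitrary: k)
    case (Suc n)
    then have "take (Suc k) u \<in> D_verts m d" by simp
    from D_verts_butlast[OF assms(1) this] show ?case
      using Suc by (simp add: butlast_take)
  qed (use assms in simp)
  have "successively (\<lambda>x y. (x, y) \<in> ?E) ?xs"
    unfolding successively_conv_nth
  proof (intro allI impI)
    fix i assume i: "Suc i < length ?xs"
    then have "(take (length u - i) u, butlast (take (length u - i) u)) \<in> ?E"
      using take[of "length u - i"] assms(3) by (intro edge) auto
    then show "(?xs ! i, ?xs ! Suc i) \<in> ?E"
      using i by (simp add: butlast_take del: upt_Suc)
  qed
  then have geo: "geodesic ?E u ?xs D_root"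
    using graph_dist_root[OF assms(1,2)]
    by (simp add: geodesic_def hd_map last_map D_root_def del: upt_Suc)
  have "?xs ! 1 \<in> set ?xs" using assms(3) by (intro nth_mem) (simp del: upt_Suc)
  moreover have "?xs ! 1 = butlast u" using assms(3)
    by (simp add: butlast_conv_take del: upt_Suc)
  ultimately show "(u, butlast u) \<in> ?E \<and> (\<exists>xs. geodesic ?E u xs D_root \<and> butlast u \<in> set xs)"
    using edge[OF assms(2,3)] geo by metis
next
  fix v assume v: "(u, v) \<in> D_edges m d \<and>
    (\<exists>xs. geodesic (D_edges m d) u xs D_root \<and> v \<in> set xs)"
  then obtain xs i where xs: "geodesic (D_edges m d) u xs D_root" "i < length xs" "v = xs ! i"
    by (auto simp: in_set_conv_nth)
  have "length xs = Suc (length u)"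
    using xs(1) graph_dist_root[OF assms(1,2)] by (simp add: geodesic_def)
  have "i \<noteq> 0"
  proof
    assume "i = 0"
    then have "v = u" using xs hd_conv_nth[of xs] by (auto simp: geodesic_def)
    then show False using D_edges_irrefl[OF assms(1)] v by blast
  qed
  moreover have "length v = length u - i"
    using length_geodesic_nth[OF assms(1,2) xs(1,2)] xs(3) by simp
  ultimately have "length u = Suc (length v)"
    using D_edges_length[OF assms(1), of u v d] v assms(3) xs(2) \<open>length xs = _\<close>
    by (cases u) auto
  then show "v = butlast u" using D_edges_butlast[OF assms(1)] v by blast
qed

lemma children_root_subset: "m \<ge> 2 \<Longrightarrow> children m d D_root \<subseteq> level1 m d"
  by (auto simp: children_def D_edges_iff D_root_def)


lemma parent_kids_sibs_disjoint:
  assumes "u \<noteq> []"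
  shows "butlast u \<notin> kids m d u \<union> sibs m u" "kids m d u \<inter> sibs m u = {}"
proof -
  have "length (butlast u) < length u" using assms by simp
  then show "butlast u \<notin> kids m d u \<union> sibs m u" "kids m d u \<inter> sibs m u = {}"
    using length_kids length_sibs[OF assms] by force+
qed

section \<open>Transition probabilities in terms of words\<close>

lemma walk_kernel_parent:
  assumes "m \<ge> 2" "u \<in> D_verts m d" "u \<noteq> []"
  shows "walk_kernel m d \<alpha> u (butlast u) = \<alpha>"
  using assms by (simp add: walk_kernel_def D_root_def parent_eq_butlast)

lemma walk_kernel_forward:
  assumes "m \<ge> 2" "u \<in> D_verts m d" "u \<noteq> []" "v \<in> kids m d u \<union> sibs m u"
  shows "walk_kernel m d \<alpha> u v = (1 - \<alpha>) / (real d * (real m - 1) + real m - 2)"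
proof -
  have "v \<noteq> butlast u" using parent_kids_sibs_disjoint(1)[OF assms(3)] assms(4) by metis
  moreover have "(u, v) \<in> D_edges m d"
    using assms by (auto simp: D_edges_iff nbrs_def)
  moreover have "real (D_degree m d) - 1 = real d * (real m - 1) + real m - 2"
    using le_Suc_ex[OF assms(1)] by (auto simp: D_degree_def algebra_simps)
  ultimately show ?thesis
    using assms(3) by (simp add: walk_kernel_def D_root_def parent_eq_butlast[OF assms(1-3)])
qed

lemma walk_kernel_root_root: "walk_kernel m d \<alpha> [] [] = \<alpha>"
  by (simp add: walk_kernel_def D_root_def)

lemma walk_kernel_pos_imp_nbrs:
  assumes "m \<ge> 2" "u \<in> D_verts m d" "walk_kernel m d \<alpha> u v \<noteq> 0"
  shows "v \<in> nbrs m d u"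
proof (cases "u = []")
  case True
  then show ?thesis
    using assms(3) children_root_subset[OF assms(1), of d]
    by (auto simp: walk_kernel_def D_root_def nbrs_def split: if_splits)
next
  case False
  then have "v = butlast u \<or> (u, v) \<in> D_edges m d"
    using assms by (auto simp: walk_kernel_def D_root_def parent_eq_butlast split: if_splits)
  then show ?thesis
    using False D_edges_iff[OF assms(1)] by (auto simp: nbrs_def)
qed

lemma walk_kernel_bounds:
  assumes "m \<ge> 2" "\<alpha> \<in> {0..1}" "d \<ge> 2"
  shows "walk_kernel m d \<alpha> u v \<in> {0..1}"
proof -
  have div: "(1 - \<alpha>) / real k \<in> {0..1}" for k
    using assms by (cases "k = 0") (auto simp: divide_simps)
  have "real (D_degree m d) - 1 = real (D_degree m d - 1)"
    using assms by (simp add: D_degree_def of_nat_diff)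
  then have "(1 - \<alpha>) / (real (D_degree m d) - 1) \<in> {0..1}"
    using div[of "D_degree m d - 1"] by (simp only:)
  then show ?thesis
    using div[of "card (children m d D_root)"] assms(2)
    unfolding walk_kernel_def by (simp del: atLeastAtMost_iff) simp
qed

text \<open>For an upper bound it is enough that the children of the root lie in
  \<open>level1\<close>; their number cancels.\<close>

lemma sum_walk_kernel_level1:
  assumes "m \<ge> 2" "\<alpha> \<in> {0..1}"
  shows "(\<Sum>v\<in>level1 m d. walk_kernel m d \<alpha> [] v) \<le> 1 - \<alpha>"
proof -
  let ?C = "children m d D_root"
  have "(\<Sum>v\<in>level1 m d. walk_kernel m d \<alpha> [] v) =
    (\<Sum>v\<in>level1 m d. if v \<in> ?C then (1 - \<alpha>) / real (card ?C) else 0)"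
    by (intro sum.cong) (auto simp: walk_kernel_def D_root_def level1_def)
  also have "\<dots> = (\<Sum>v\<in>?C. (1 - \<alpha>) / real (card ?C))"
    using children_root_subset[OF assms(1), of d]
    by (simp add: sum.If_cases Int_absorb1)
  also have "\<dots> \<le> 1 - \<alpha>" using assms by (cases "card ?C = 0") auto
  finally show ?thesis .
qed

text \<open>Meant for sums over children or siblings in which the predecessor \<open>w\<close> of
  the current position, being visited, lacks the handover term \<open>y\<close>.\<close>

lemma sum_except_one:
  fixes x y :: real
  assumes "finite A" "\<And>z. z \<in> A \<Longrightarrow> f z \<le> x" "w \<in> A \<Longrightarrow> f w \<le> x - y"
  shows "sum f A \<le> real (card A) * x - (if w \<in> A then y else 0)"
proof -
  have "sum f A \<le> (\<Sum>z\<in>A. x - (if z = w then y else 0))"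
    using assms by (intro sum_mono) auto
  also have "\<dots> = real (card A) * x - (if w \<in> A then y else 0)"
    using assms(1) by (simp add: sum_subtractf)
  finally show ?thesis .
qed

lemma sum_UNION_le:
  fixes f :: "'b \<Rightarrow> real"
  assumes "finite A" "\<And>x. x \<in> A \<Longrightarrow> finite (B x)" "\<And>z. 0 \<le> f z"
  shows "sum f (\<Union>x\<in>A. B x) \<le> (\<Sum>x\<in>A. sum f (B x))"
  using assms(1,2)
proof (induction A)
  case (insert x A)
  let ?U = "\<Union>x\<in>A. B x"
  have "sum f (B x \<union> ?U) + sum f (B x \<inter> ?U) = sum f (B x) + sum f ?U"
    using insert by (intro sum.union_inter) auto
  moreover have "0 \<le> sum f (B x \<inter> ?U)" using assms(3) by (intro sum_nonneg) auto
  moreover have "sum f ?U \<le> (\<Sum>x\<in>A. sum f (B x))" using insert by auto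
  ultimately show ?case using insert by simp
qed simp

section \<open>A supersolution for the weights\<close>

text \<open>Reverses the last step into \<open>u\<close>; the three alternatives are the types of
  arrival that \<open>pot\<close> distinguishes.\<close>

lemma nbrs_converse:
  assumes "m \<ge> 2" "w \<in> D_verts m d" "u \<in> nbrs m d w" "u \<noteq> []"
  shows "w = butlast u \<or> w \<in> kids m d u \<or> w \<in> sibs m u"
proof (cases "w = []")
  case True
  then show ?thesis using assms by (auto simp: nbrs_def level1_def)
next
  case False
  then obtain v i g where w: "w = v @ [(i, g)]"
    by (metis append_butlast_last_id prod.exhaust)
  from assms(3) False consider "u = v" | "u \<in> kids m d w" | "u \<in> sibs m w"
    by (auto simp: nbrs_def w)
  then show ?thesis
  proof cases
    case 1
    then have "fst (last u) \<noteq> i"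
      using assms by (cases u rule: rev_cases) (auto simp: D_verts_iff w distinct_adj_append_iff)
    then have "w \<in> kids m d u" using 1 assms by (auto simp: D_verts_iff kids_def w)
    then show ?thesis by simp
  next
    case 2
    then show ?thesis by (auto simp: kids_def)
  next
    case 3
    then have "w \<in> sibs m u" using assms(1,2) by (auto simp: D_verts_iff sibs_def w)
    then show ?thesis by simp
  qed
qed

text \<open>Keeps the set of visited sites closed under parents when a chain is extended from
  \<open>u\<close> to \<open>y\<close>.\<close>

lemma butlast_nbrs: "y \<in> nbrs m d u \<Longrightarrow> butlast y \<in> {u, butlast u, butlast (butlast u)}"
  by (auto simp: nbrs_def level1_def kids_def sibs_def split: if_splits)

locale subcritical =
  fixes m d :: nat and \<alpha> p :: real
  assumes m: "m \<ge> 2" and d: "d \<ge> 2" and \<alpha>: "\<alpha> \<in> {0..1}" and p: "p \<in> {0..1}"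
    and psi: "psi m d \<alpha> p < 1"
begin

abbreviation "V \<equiv> D_verts m d"
abbreviation "K \<equiv> walk_kernel m d \<alpha>"
abbreviation "nb \<equiv> nbrs m d"

text \<open>\<open>\<kappa>\<close> and \<open>\<beta>\<close> count the children and the siblings
  of a non-root vertex, so \<open>\<kappa> + \<beta>\<close> is the degree minus one and
  \<open>\<tau>\<close> is the weight of a step, survival included, to one given child or
  sibling.\<close>

definition \<kappa> :: real where "\<kappa> = real d * (real m - 1)"
definition \<beta> :: real where "\<beta> = real m - 2"
definition \<tau> :: real where "\<tau> = p * (1 - \<alpha>) / (\<kappa> + \<beta>)"

lemma kappa_beta: "\<beta> \<ge> 0" "\<kappa> \<ge> 2 * \<beta> + 2"
proof -
  show "\<beta> \<ge> 0" using m by (simp add: \<beta>_def)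
  have "2 * (real m - 1) \<le> real d * (real m - 1)"
    using m d by (intro mult_right_mono) auto
  then show "\<kappa> \<ge> 2 * \<beta> + 2" by (simp add: \<kappa>_def \<beta>_def)
qed

lemma tau_eq: "\<tau> * (\<kappa> + \<beta>) = p * (1 - \<alpha>)"
  using kappa_beta by (simp add: \<tau>_def)

lemma tau_nonneg: "\<tau> \<ge> 0"
  using kappa_beta p \<alpha> by (simp add: \<tau>_def)

lemma tau_le: "\<tau> * (\<kappa> + \<beta>) \<le> 1"
  unfolding tau_eq using p \<alpha> by (auto intro: mult_le_one)

lemma tau_le_half: "\<tau> \<le> 1 / 2"
proof -
  have "\<tau> * 2 \<le> \<tau> * (\<kappa> + \<beta>)" using kappa_beta tau_nonneg by (intro mult_left_mono) auto
  then show ?thesis using tau_le by simp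
qed

text \<open>One minus the left side is the value at 1 of the quadratic with larger root
  \<open>psi\<close>; completing the square gives the difference in \<open>f\<close>.\<close>

lemma crit: "2 * \<kappa> * \<tau> + (2 * \<beta> * \<tau> + \<alpha> * p) * (1 - \<tau>) < 1"
proof -
  define D where "D = (2 - \<alpha>)\<^sup>2 - 4 * (1 - \<alpha>) * (\<beta> * (2 - \<alpha>) + \<alpha> * \<kappa>) / (\<kappa> + \<beta>)\<^sup>2"
  have D: "p * (2 - \<alpha> + sqrt D) < 2"
    using psi by (simp add: psi_def D_def \<kappa>_def \<beta>_def algebra_simps)
  have "(1 - \<alpha>) * (\<beta> * (2 - \<alpha>) + \<alpha> * \<kappa>) = (1 - \<alpha>) * (2 * \<beta> * (1 - \<alpha>) + \<alpha> * (\<kappa> + \<beta>))"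
    by (simp add: algebra_simps)
  then have "p\<^sup>2 * D = (p * (2 - \<alpha>))\<^sup>2 - 4 * \<tau> * (2 * \<beta> * \<tau> + \<alpha> * p)"
    using kappa_beta by (simp add: D_def \<tau>_def field_simps power2_eq_square)
  moreover have "p * (2 - \<alpha>) = 2 * \<tau> * (\<kappa> + \<beta>) + \<alpha> * p"
    using tau_eq by (simp add: algebra_simps)
  ultimately have f: "4 * (1 - (2 * \<kappa> * \<tau> + (2 * \<beta> * \<tau> + \<alpha> * p) * (1 - \<tau>))) =
      (2 - p * (2 - \<alpha>))\<^sup>2 - p\<^sup>2 * D"
    by (simp add: algebra_simps power2_eq_square)
  have "p\<^sup>2 * D < (2 - p * (2 - \<alpha>))\<^sup>2"
  proof (cases "D \<ge> 0")
    case True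
    have "0 \<le> p * sqrt D" "p * sqrt D < 2 - p * (2 - \<alpha>)"
      using D p True by (auto simp: algebra_simps)
    then have "(p * sqrt D)\<^sup>2 < (2 - p * (2 - \<alpha>))\<^sup>2"
      by (intro power_strict_mono) auto
    then show ?thesis using True by (simp add: power_mult_distrib)
  next
    \<comment> \<open>Without real roots the quadratic is positive everywhere. The case
      \<open>p = 0\<close> is separate because \<open>p\<^sup>2 * D\<close> is then not strictly
      negative.\<close>
    case False
    show ?thesis
    proof (cases "p = 0")
      case False
      then have "p\<^sup>2 * D < 0" using \<open>\<not> D \<ge> 0\<close> by (simp add: mult_pos_neg)
      then show ?thesis by (smt (verit) zero_le_power2)
    qed simp
  qed
  then show ?thesis using f by simp
qed

text \<open>The growth rate is governed by a linear system with one unknown for each type of arrival,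
  with or without a handover at that moment. The perturbation of order \<open>\<tau>\<^sup>2\<close> pays for the
  fact that a walk coming from a sibling cannot hand over to that sibling: without the saving at
  consecutive handovers (the factor \<open>1 - \<tau>\<close>) the critical value of the system would differ from that of
  \<open>psi\<close> in the wrong direction when \<open>m \<ge> 3\<close>.\<close>

definition \<gamma> :: real where "\<gamma> = 1 - \<tau>\<^sup>2"
definition \<sigma> :: real where "\<sigma> = \<gamma> * (1 - \<tau> + 2 * \<tau>\<^sup>2)"

text \<open>The arguments are the predecessor, the position and whether a handover just took place
  there. An arrival from the parent has the reference value 1. An arrival from a child or sibling
  \<open>w\<close> loses the handover to the visited \<open>w\<close>, worth
  \<open>\<tau> * \<gamma>\<close> or \<open>\<tau> * \<sigma>\<close>. \<open>\<gamma>\<close> and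
  \<open>\<sigma>\<close> are the values after a handover. The root has the value of a return from a
  child, whatever the predecessor.\<close>

definition pot :: "vertex \<Rightarrow> vertex \<Rightarrow> bool \<Rightarrow> real" where
  "pot w u h = (if u = [] \<or> butlast w = u then 1 - \<tau> * \<gamma>
     else if w = butlast u then (if h then \<gamma> else 1)
     else (if h then \<sigma> else 1 - \<tau> * \<sigma>))"

text \<open>The one-step sum at a non-root vertex with every child and sibling counted as fresh and
  no extra factor on handovers; a move to the parent hands nothing over.\<close>

definition total :: real where
  "total = \<kappa> * \<tau> * (1 + \<gamma>) + \<beta> * \<tau> * (1 - \<tau> * \<sigma> + \<sigma>) + \<alpha> * p * (1 - \<tau> * \<gamma>)"

text \<open>One minus the smaller of two slacks, the one for non-root vertices and the one for the
  root.\<close>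

definition \<theta> :: real where
  "\<theta> = 1 - min (1 - total) (1 - \<tau> * \<gamma> - \<alpha> * p * (1 - \<tau> * \<gamma>) - p * (1 - \<alpha>))"

lemma gamma_bounds: "3 / 4 \<le> \<gamma>" "\<gamma> \<le> 1"
proof -
  have "\<tau>\<^sup>2 \<le> (1 / 2)\<^sup>2" using tau_nonneg tau_le_half by (intro power_mono) auto
  then show "3 / 4 \<le> \<gamma>" "\<gamma> \<le> 1" by (auto simp: \<gamma>_def power2_eq_square)
qed

lemma sigma_bounds: "0 \<le> \<sigma>" "\<sigma> \<le> 1"
proof -
  have "\<tau> * (1 - 2 * \<tau>) \<ge> 0" using tau_nonneg tau_le_half by simp
  then have "1 - \<tau> + 2 * \<tau>\<^sup>2 \<le> 1" by (simp add: algebra_simps power2_eq_square)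
  moreover have "0 \<le> 1 - \<tau> + 2 * \<tau>\<^sup>2" using tau_le_half zero_le_power2[of \<tau>] by linarith
  ultimately show "0 \<le> \<sigma>" "\<sigma> \<le> 1" using gamma_bounds unfolding \<sigma>_def by (auto intro: mult_le_one)
qed

text \<open>The condition for arriving from a sibling with a handover. The factor
  \<open>1 - \<tau> + 2 * \<tau>\<^sup>2\<close> in \<open>\<sigma>\<close> is the second-order
  Taylor polynomial of \<open>1 / (1 + \<tau> - \<tau>\<^sup>2)\<close>, and its error has the
  required sign.\<close>

lemma gamma_le_sigma: "\<gamma> \<le> \<sigma> * (1 + \<tau> - \<tau>\<^sup>2)"
proof -
  have "(1 - \<tau> + 2 * \<tau>\<^sup>2) * (1 + \<tau> - \<tau>\<^sup>2) - 1 = \<tau> ^ 3 * (3 - 2 * \<tau>)"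
    by (simp add: algebra_simps power2_eq_square power3_eq_cube)
  also have "\<dots> \<ge> 0" using tau_nonneg tau_le_half by simp
  finally have "\<gamma> * 1 \<le> \<gamma> * ((1 - \<tau> + 2 * \<tau>\<^sup>2) * (1 + \<tau> - \<tau>\<^sup>2))"
    using gamma_bounds by (intro mult_left_mono) auto
  then show ?thesis by (simp add: \<sigma>_def mult.assoc)
qed

text \<open>The right side is what the factor \<open>1 - \<tau>\<close> on the next handovers saves,
  the left side is \<open>1 - \<gamma>\<close>: the saving covers the lower value given to arriving
  from the parent with a handover.\<close>

lemma penalty_ge: "\<tau>\<^sup>2 \<le> \<tau>\<^sup>2 * (\<kappa> * \<gamma> + \<beta> * \<sigma>)"
proof -
  have "2 * (3 / 4) \<le> \<kappa> * \<gamma>" using kappa_beta gamma_bounds by (intro mult_mono) auto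
  moreover have "\<beta> * \<sigma> \<ge> 0" using kappa_beta sigma_bounds by simp
  ultimately have "1 \<le> \<kappa> * \<gamma> + \<beta> * \<sigma>" by simp
  from mult_left_mono[OF this, of "\<tau>\<^sup>2"] show ?thesis by simp
qed

text \<open>Compared with \<open>crit\<close>, the smaller value after a handover to a child gains
  \<open>\<kappa> * \<tau> ^ 3\<close>, while siblings and the parent cost
  \<open>(2 * \<beta> + \<alpha> * p) * \<tau> ^ 3\<close>, up to a favourable term of higher order.
  The gain wins by \<open>\<kappa> \<ge> 2 * \<beta> + 2\<close>, which rests on
  \<open>d \<ge> 2\<close>.\<close>

lemma total_less_1: "total < 1"
proof -
  have "0 \<le> \<tau> ^ 3 * (\<kappa> - 2 * \<beta> - \<alpha> * p)"
    using kappa_beta tau_nonneg p \<alpha> mult_le_one[of \<alpha> p] by (intro mult_nonneg_nonneg) auto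
  moreover have "0 \<le> \<beta> * \<tau> * (\<tau> ^ 4 * (3 - 2 * \<tau>))"
    using kappa_beta tau_nonneg tau_le_half by simp
  moreover have "2 * \<kappa> * \<tau> + (2 * \<beta> * \<tau> + \<alpha> * p) * (1 - \<tau>) - total =
      \<tau> ^ 3 * (\<kappa> - 2 * \<beta> - \<alpha> * p) + \<beta> * \<tau> * (\<tau> ^ 4 * (3 - 2 * \<tau>))"
    unfolding total_def \<sigma>_def \<gamma>_def by algebra
  ultimately show ?thesis using crit by simp
qed

lemma \<theta>_bounds: "0 \<le> \<theta>" "\<theta> < 1"
proof -
  have tc: "0 \<le> \<tau> * \<gamma>" "\<tau> * \<gamma> \<le> \<tau>" using tau_nonneg gamma_bounds by (auto intro: mult_left_le)
  have ts: "0 \<le> \<tau> * \<sigma>" "\<tau> * \<sigma> \<le> \<tau>" using tau_nonneg sigma_bounds by (auto intro: mult_left_le)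
  have ap: "0 \<le> \<alpha> * p" "\<alpha> * p \<le> 1" "0 \<le> p * (1 - \<alpha>)"
    using \<alpha> p by (auto intro: mult_le_one)
  have "0 \<le> total"
    unfolding total_def using kappa_beta tau_nonneg gamma_bounds tc ts tau_le_half ap(1) sigma_bounds
    by (intro add_nonneg_nonneg mult_nonneg_nonneg[of "\<alpha> * p"] mult_nonneg_nonneg[of "\<kappa> * \<tau>"]
        mult_nonneg_nonneg[of "\<beta> * \<tau>"]) auto
  \<comment> \<open>Slack at the root. The left side of \<open>crit\<close> contains
    \<open>\<tau> * (\<kappa> + \<beta>)\<close> twice; one copy is
    \<open>p * (1 - \<alpha>)\<close>, and the other, reduced by the subtracted term, is still at
    least \<open>\<tau> * (1 - \<alpha> * p)\<close>.\<close>
  moreover have "1 - \<tau> * \<gamma> - \<alpha> * p * (1 - \<tau> * \<gamma>) - p * (1 - \<alpha>) > 0"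
  proof -
    have "0 \<le> \<tau> * (\<kappa> - \<beta> - 1) + 2 * \<beta> * \<tau> * (1 - \<tau>)"
      using kappa_beta tau_nonneg tau_le_half by simp
    then have "\<tau> * (1 - \<alpha> * p) \<le> \<tau> * (\<kappa> + \<beta>) - \<tau> * (2 * \<beta> * \<tau> + \<alpha> * p)"
      by (simp add: algebra_simps)
    moreover have "\<tau> * \<gamma> * (1 - \<alpha> * p) \<le> \<tau> * (1 - \<alpha> * p)"
      using tc ap by (intro mult_right_mono) auto
    moreover have "2 * \<kappa> * \<tau> + (2 * \<beta> * \<tau> + \<alpha> * p) * (1 - \<tau>) =
        2 * (\<tau> * (\<kappa> + \<beta>)) + \<alpha> * p - \<tau> * (2 * \<beta> * \<tau> + \<alpha> * p)"
      by (simp add: algebra_simps)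
    ultimately have "\<tau> * \<gamma> * (1 - \<alpha> * p) < 1 - \<tau> * (\<kappa> + \<beta>) - \<alpha> * p"
      using crit by linarith
    then show ?thesis unfolding tau_eq by (simp add: algebra_simps)
  qed
  ultimately show "0 \<le> \<theta>" "\<theta> < 1"
    using total_less_1 by (auto simp: \<theta>_def)
qed

text \<open>An additive slack becomes a multiplicative one because the potential \<open>f\<close> is
  at most 1.\<close>

lemma \<theta>_ge:
  assumes "x \<le> f - (1 - total)" "0 \<le> f" "f \<le> 1"
  shows "x \<le> \<theta> * f"
proof -
  have "f * min (1 - total) (1 - \<tau> * \<gamma> - \<alpha> * p * (1 - \<tau> * \<gamma>) - p * (1 - \<alpha>)) \<le> f * (1 - total)"
    using assms(2) by (intro mult_left_mono) auto
  also have "\<dots> \<le> 1 - total" using assms total_less_1 by (simp add: mult_left_le_one_le)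
  finally show ?thesis using assms(1) by (simp add: \<theta>_def algebra_simps)
qed

section \<open>The supersolution inequality for one step\<close>

lemma forward_kernel:
  assumes "u \<in> V" "u \<noteq> []" "y \<in> kids m d u \<union> sibs m u"
  shows "p * K u y = \<tau>"
  using walk_kernel_forward[OF m assms] by (simp add: \<tau>_def \<kappa>_def \<beta>_def)

lemma pot_nonneg: "0 \<le> pot w u h" "pot w u h \<le> 1"
proof -
  have "0 \<le> \<tau> * \<gamma>" "\<tau> * \<gamma> \<le> 1" "0 \<le> \<tau> * \<sigma>" "\<tau> * \<sigma> \<le> 1"
    using tau_nonneg tau_le_half gamma_bounds sigma_bounds by (auto intro: mult_le_one)
  then show "0 \<le> pot w u h" "pot w u h \<le> 1"
    using gamma_bounds sigma_bounds by (auto simp: pot_def)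
qed

text \<open>Fresh visits from the root would violate the supersolution inequality, the root having more
  children than other vertices. There are only finitely many such visits, so each of them may be
  paid for by a factor 2.\<close>

definition remaining :: "vertex set \<Rightarrow> real" where
  "remaining X = 2 ^ card (level1 m d - X)"

lemma remaining_mono: "remaining (insert y X) \<le> remaining X"
  unfolding remaining_def by (intro power_increasing card_mono) auto

lemma remaining_insert:
  assumes "y \<in> level1 m d" "y \<notin> X"
  shows "remaining (insert y X) = remaining X / 2"
proof -
  have "level1 m d - X = insert y (level1 m d - insert y X)" using assms by auto
  then have "card (level1 m d - X) = Suc (card (level1 m d - insert y X))"
    by (metis card_insert_disjoint Diff_iff finite_Diff finite_nbrs(1) insertI1)
  then show ?thesis by (simp add: remaining_def)
qed

text \<open>If handovers take place at \<open>u\<close> and then at \<open>y\<close>, the frog that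
  woke \<open>u\<close> must not survive and step to \<open>y\<close> as well; its own next step
  supplies this factor, independently of the frog of \<open>u\<close>.\<close>

definition handover_factor :: "vertex \<Rightarrow> bool \<Rightarrow> vertex \<Rightarrow> real" where
  "handover_factor u h y = (if h then 1 - p * K u y else 1)"

lemma handover_factor_bounds: "handover_factor u h y \<in> {0..1}"
  using walk_kernel_bounds[OF m \<alpha> d, of u y] p mult_le_one[of p "K u y"]
  by (auto simp: handover_factor_def)

lemma pK_bounds: "0 \<le> p * K u y" "p * K u y \<le> 1"
  using walk_kernel_bounds[OF m \<alpha> d, of u y] p mult_le_one[of p "K u y"] by auto

definition step_term :: "vertex \<Rightarrow> bool \<Rightarrow> vertex set \<Rightarrow> vertex \<Rightarrow> real" where
  "step_term u h X y = p * K u y *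
     (pot u y False + (if y \<in> X then 0 else handover_factor u h y * pot u y True))"

lemma step_term_nonneg: "0 \<le> step_term u h X y"
  unfolding step_term_def
  using pK_bounds[of u y] pot_nonneg handover_factor_bounds[of u h y]
  by (auto intro!: mult_nonneg_nonneg add_nonneg_nonneg)

text \<open>From \<open>total\<close> one subtracts the handover to the visited predecessor
  \<open>w\<close>, if that is a child or sibling, and after a handover also the saving from the
  factor \<open>1 - \<tau>\<close>. In each of the three cases for \<open>w\<close> at most
  \<open>pot w u h - (1 - total)\<close> remains.\<close>

lemma sum_step_term_nonroot:
  assumes u: "u \<in> V" "u \<noteq> []" and w: "w \<in> V" "w \<in> X" "u \<in> nb w"
    and X: "butlast u \<in> X" and h: "h \<Longrightarrow> butlast w \<noteq> u"
  shows "(\<Sum>y\<in>nb u. step_term u h X y) \<le> \<theta> * pot w u h"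
proof -
  define r where "r = (if h then 1 - \<tau> else 1)"
  have r: "0 \<le> r" using tau_le_half by (auto simp: r_def)
  have len: "length (butlast u) < length u" using u by simp
  have parent: "step_term u h X (butlast u) = \<alpha> * p * (1 - \<tau> * \<gamma>)"
    using X walk_kernel_parent[OF m u] by (simp add: step_term_def pot_def)
  have kid: "step_term u h X y = \<tau> * (1 + (if y \<in> X then 0 else r * \<gamma>))" if "y \<in> kids m d u" for y
  proof -
    have "butlast y = u" using that by (auto simp: kids_def)
    moreover have "y \<noteq> []" using that by (auto simp: kids_def)
    moreover have "butlast u \<noteq> y" using len length_kids[OF that] by auto
    ultimately show ?thesis using that forward_kernel[OF u, of y]
      by (simp add: step_term_def pot_def handover_factor_def r_def)
  qed
  have sib: "step_term u h X y = \<tau> * (1 - \<tau> * \<sigma> + (if y \<in> X then 0 else r * \<sigma>))" if "y \<in> sibs m u" for y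
  proof -
    have ly: "length y = length u" using length_sibs[OF u(2) that] .
    then have "length (butlast y) < length u" using u by simp
    then have "u \<noteq> butlast y" "butlast u \<noteq> y" "y \<noteq> []"
      using len u ly by (metis less_irrefl, metis less_irrefl, auto)
    then show ?thesis using that forward_kernel[OF u, of y]
      by (simp add: step_term_def pot_def handover_factor_def r_def)
  qed
  have "sum (step_term u h X) (kids m d u) \<le> real (card (kids m d u)) * (\<tau> * (1 + r * \<gamma>))
      - (if w \<in> kids m d u then \<tau> * (r * \<gamma>) else 0)"
  proof (rule sum_except_one)
    show "step_term u h X z \<le> \<tau> * (1 + r * \<gamma>)" if "z \<in> kids m d u" for z
      unfolding kid[OF that] using tau_nonneg r gamma_bounds by (intro mult_left_mono) auto
    show "step_term u h X w \<le> \<tau> * (1 + r * \<gamma>) - \<tau> * (r * \<gamma>)" if "w \<in> kids m d u"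
      unfolding kid[OF that] using w(2) by (simp add: algebra_simps)
  qed simp
  then have kids: "sum (step_term u h X) (kids m d u) \<le>
      \<kappa> * (\<tau> * (1 + r * \<gamma>)) - (if w \<in> kids m d u then \<tau> * (r * \<gamma>) else 0)"
    unfolding card_kids[OF m u] \<kappa>_def .
  have "sum (step_term u h X) (sibs m u) \<le> real (card (sibs m u)) * (\<tau> * (1 - \<tau> * \<sigma> + r * \<sigma>))
      - (if w \<in> sibs m u then \<tau> * (r * \<sigma>) else 0)"
  proof (rule sum_except_one)
    show "step_term u h X z \<le> \<tau> * (1 - \<tau> * \<sigma> + r * \<sigma>)" if "z \<in> sibs m u" for z
      unfolding sib[OF that] using tau_nonneg r sigma_bounds by (intro mult_left_mono) auto
    show "step_term u h X w \<le> \<tau> * (1 - \<tau> * \<sigma> + r * \<sigma>) - \<tau> * (r * \<sigma>)" if "w \<in> sibs m u"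
      unfolding sib[OF that] using w(2) by (simp add: algebra_simps)
  qed simp
  then have sibs: "sum (step_term u h X) (sibs m u) \<le>
      \<beta> * (\<tau> * (1 - \<tau> * \<sigma> + r * \<sigma>)) - (if w \<in> sibs m u then \<tau> * (r * \<sigma>) else 0)"
    unfolding card_sibs[OF m u] \<beta>_def .
  have "(\<Sum>y\<in>nb u. step_term u h X y) = step_term u h X (butlast u) +
      (sum (step_term u h X) (kids m d u) + sum (step_term u h X) (sibs m u))"
    using parent_kids_sibs_disjoint[OF u(2), of m d] u by (simp add: nbrs_def sum.union_disjoint)
  also have "\<dots> \<le> \<alpha> * p * (1 - \<tau> * \<gamma>) + (\<kappa> * (\<tau> * (1 + r * \<gamma>)) + \<beta> * (\<tau> * (1 - \<tau> * \<sigma> + r * \<sigma>)))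
      - ((if w \<in> kids m d u then \<tau> * (r * \<gamma>) else 0) + (if w \<in> sibs m u then \<tau> * (r * \<sigma>) else 0))"
    using parent kids sibs by simp
  also have "\<alpha> * p * (1 - \<tau> * \<gamma>) + (\<kappa> * (\<tau> * (1 + r * \<gamma>)) + \<beta> * (\<tau> * (1 - \<tau> * \<sigma> + r * \<sigma>))) =
      total - (if h then \<tau>\<^sup>2 * (\<kappa> * \<gamma> + \<beta> * \<sigma>) else 0)"
    by (simp add: total_def r_def algebra_simps power2_eq_square)
  finally have le: "(\<Sum>y\<in>nb u. step_term u h X y) \<le> total - (if h then \<tau>\<^sup>2 * (\<kappa> * \<gamma> + \<beta> * \<sigma>) else 0)
      - ((if w \<in> kids m d u then \<tau> * (r * \<gamma>) else 0) + (if w \<in> sibs m u then \<tau> * (r * \<sigma>) else 0))" .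
  have "(\<Sum>y\<in>nb u. step_term u h X y) \<le> pot w u h - (1 - total)"
    using nbrs_converse[OF m w(1,3) u(2)]
  proof (elim disjE)
    assume wu: "w = butlast u"
    then have "length (butlast w) < length u" using len by simp
    then have "butlast w \<noteq> u" by (metis less_irrefl)
    then have "pot w u h = (if h then \<gamma> else 1)" using u wu by (simp add: pot_def)
    then show ?thesis using le penalty_ge parent_kids_sibs_disjoint(1)[OF u(2), of m d]
      by (auto simp: wu \<gamma>_def)
  next
    assume wu: "w \<in> kids m d u"
    then have bl: "butlast w = u" by (auto simp: kids_def)
    with h have "\<not> h" by auto
    moreover have "w \<notin> sibs m u" using wu parent_kids_sibs_disjoint(2)[OF u(2), of m d] by blast
    ultimately show ?thesis using le wu bl by (simp add: pot_def r_def)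
  next
    assume wu: "w \<in> sibs m u"
    then have "length w = length u" using length_sibs u by auto
    then have "length (butlast w) < length u" "length w = length u" using u by auto
    then have "w \<noteq> butlast u" "butlast w \<noteq> u" using len by (metis less_irrefl)+
    then have pot: "pot w u h = (if h then \<sigma> else 1 - \<tau> * \<sigma>)" using u by (simp add: pot_def)
    have nk: "w \<notin> kids m d u" using wu parent_kids_sibs_disjoint(2)[OF u(2), of m d] by blast
    show ?thesis
    proof (cases h)
      case True
      have "\<sigma> * (1 + \<tau> - \<tau>\<^sup>2) = \<sigma> + \<tau> * ((1 - \<tau>) * \<sigma>)"
        by (simp add: algebra_simps power2_eq_square)
      then show ?thesis using le penalty_ge gamma_le_sigma \<gamma>_def True wu nk pot by (simp add: r_def)
    next
      case False
      then show ?thesis using le wu nk pot by (simp add: r_def)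
    qed
  qed
  then show ?thesis using \<theta>_ge pot_nonneg by blast
qed

text \<open>At the root the total kernel mass replaces the count of children, and the weight
  \<open>1 + \<gamma> \<le> 2\<close> of a fresh visit is absorbed by the halving of
  \<open>remaining\<close>.\<close>

lemma sum_step_term_root:
  assumes "[] \<in> X"
  shows "(\<Sum>y\<in>nb []. step_term [] False X y * remaining (insert y X)) \<le> \<theta> * pot w [] False * remaining X"
proof -
  let ?R = "remaining X"
  have R: "?R \<ge> 0" by (simp add: remaining_def)
  have tc: "\<tau> * \<gamma> \<le> 1" "0 \<le> \<tau> * \<gamma>" using tau_nonneg tau_le_half gamma_bounds by (auto intro: mult_le_one)
  have kid: "step_term [] False X y * remaining (insert y X) \<le> p * K [] y * ?R"
    if y: "y \<in> level1 m d" for y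
  proof -
    have pot: "pot [] y False = 1" "pot [] y True = \<gamma>" using y by (auto simp: level1_def pot_def)
    show ?thesis
    proof (cases "y \<in> X")
      case True
      then show ?thesis using pot by (simp add: step_term_def insert_absorb)
    next
      case False
      have "(p * K [] y * ?R) * ((1 + \<gamma>) / 2) \<le> p * K [] y * ?R"
        using gamma_bounds pK_bounds[of "[]" y] R by (intro mult_right_le_one_le) auto
      moreover have "step_term [] False X y * remaining (insert y X) =
          (p * K [] y * ?R) * ((1 + \<gamma>) / 2)"
        using pot False
        by (simp add: step_term_def handover_factor_def remaining_insert[OF y False])
      ultimately show ?thesis by simp
    qed
  qed
  have "(\<Sum>y\<in>nb []. step_term [] False X y * remaining (insert y X)) =
      step_term [] False X [] * remaining (insert [] X) +
      (\<Sum>y\<in>level1 m d. step_term [] False X y * remaining (insert y X))"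
    by (subst nbrs_def) (auto simp: level1_def intro!: sum.insert)
  also have "step_term [] False X [] * remaining (insert [] X) = \<alpha> * p * (1 - \<tau> * \<gamma>) * ?R"
    using assms by (simp add: step_term_def pot_def walk_kernel_root_root insert_absorb)
  also have "(\<Sum>y\<in>level1 m d. step_term [] False X y * remaining (insert y X)) \<le>
      (\<Sum>y\<in>level1 m d. p * K [] y * ?R)"
    by (intro sum_mono kid)
  also have "\<dots> = (p * (\<Sum>y\<in>level1 m d. K [] y)) * ?R"
    by (simp add: sum_distrib_left sum_distrib_right)
  also have "\<dots> \<le> (p * (1 - \<alpha>)) * ?R"
    using sum_walk_kernel_level1[OF m \<alpha>] p R by (intro mult_right_mono mult_left_mono) auto
  also have "\<alpha> * p * (1 - \<tau> * \<gamma>) * ?R + (p * (1 - \<alpha>)) * ?R =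
      (\<alpha> * p * (1 - \<tau> * \<gamma>) + p * (1 - \<alpha>)) * ?R" by (simp add: algebra_simps)
  also have "\<dots> \<le> (\<theta> * pot w [] False) * ?R"
  proof (intro mult_right_mono R)
    let ?g = "1 - \<tau> * \<gamma> - \<alpha> * p * (1 - \<tau> * \<gamma>) - p * (1 - \<alpha>)"
    have "(1 - \<tau> * \<gamma>) * (1 - \<theta>) \<le> 1 - \<theta>"
      using \<theta>_bounds tc by (intro mult_left_le_one_le) auto
    moreover have "1 - \<theta> \<le> ?g" by (simp add: \<theta>_def)
    ultimately show "\<alpha> * p * (1 - \<tau> * \<gamma>) + p * (1 - \<alpha>) \<le> \<theta> * pot w [] False"
      by (simp add: pot_def algebra_simps)
  qed
  finally show ?thesis by simp
qed

lemma sum_step_term: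
  assumes u: "u \<in> V" "u \<noteq> [] \<Longrightarrow> u \<in> nb w" and w: "w \<in> V" "w \<in> X"
    and X: "butlast u \<in> X" and h: "h \<Longrightarrow> u \<noteq> [] \<and> butlast w \<noteq> u"
  shows "(\<Sum>y\<in>nb u. step_term u h X y * remaining (insert y X)) \<le> \<theta> * (pot w u h * remaining X)"
proof (cases "u = []")
  case True
  then show ?thesis using sum_step_term_root[of X w] X h by (cases h) (auto simp: mult.assoc)
next
  case False
  have "(\<Sum>y\<in>nb u. step_term u h X y * remaining (insert y X)) \<le>
      (\<Sum>y\<in>nb u. step_term u h X y) * remaining X"
    unfolding sum_distrib_right
    by (intro sum_mono mult_left_mono remaining_mono step_term_nonneg)
  also have "\<dots> \<le> (\<theta> * pot w u h) * remaining X"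
    using sum_step_term_nonroot[OF u(1) False w u(2)[OF False] X] h
    by (intro mult_right_mono) (auto simp: remaining_def)
  finally show ?thesis by (simp add: mult.assoc)
qed

end

section \<open>Chains of frogs\<close>

text \<open>A chain records how the process may have reached a vertex: a list of segments, the newest
  first. A segment consists of the sites visited by the frog of \<open>last xs\<close>, again newest first, and
  possibly of a site to which that frog must not go next. A frog is handed the chain at a site that
  the chain has not visited before. If this happens at two consecutive moments, at \<open>u\<close> and then at
  \<open>y\<close>, then the frog that woke up \<open>u\<close> must not go from \<open>u\<close> to \<open>y\<close>, as it could be
  held responsible for waking up \<open>y\<close> itself.\<close>

type_synonym chain = "(vertex list \<times> vertex option) list"

fun walk_on :: "vertex \<Rightarrow> chain \<Rightarrow> chain" where
  "walk_on y [] = []"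
| "walk_on y ((xs, f) # c) = (y # xs, f) # c"

fun forbid :: "vertex \<Rightarrow> chain \<Rightarrow> chain" where
  "forbid y [] = []"
| "forbid y ((xs, f) # c) = (xs, Some y) # c"

text \<open>The site \<open>y\<close> is stored twice: as the last step of the old frog, which
  carries the weight of that step, and as the start of the new segment, which weighs 1. A segment of
  length 1 belongs to a frog that has not moved, so the handovers are consecutive; for the initial
  frog \<open>forbid\<close> meets the empty list.\<close>

fun hand_over :: "vertex \<Rightarrow> chain \<Rightarrow> chain" where
  "hand_over y [] = []"
| "hand_over y ((xs, f) # c) = ([y], None) # (y # xs, f) # (if length xs = 1 then forbid y c else c)"

definition visited :: "chain \<Rightarrow> vertex set" where
  "visited c = (\<Union>g\<in>set c. set (fst g))"

definition pos :: "chain \<Rightarrow> vertex" where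
  "pos c = hd (fst (hd c))"

definition just_handed :: "chain \<Rightarrow> bool" where
  "just_handed c \<longleftrightarrow> length (fst (hd c)) = 1 \<and> tl c \<noteq> []"

text \<open>Right after a handover the predecessor is the second entry of the older segment, whose
  first entry repeats the handover site. The default \<open>[]\<close> makes the root its own
  predecessor in the initial chain.\<close>

fun prev :: "chain \<Rightarrow> vertex" where
  "prev ((u # v # xs, f) # c) = v"
| "prev (([u], f) # (x # v # ys, f') # c) = v"
| "prev _ = []"

primrec chains :: "nat \<Rightarrow> nat \<Rightarrow> nat \<Rightarrow> chain set" where
  "chains m d 0 = {[([D_root], None)]}"
| "chains m d (Suc n) = (\<Union>c\<in>chains m d n. \<Union>y\<in>nbrs m d (pos c).
     insert (walk_on y c) (if y \<in> visited c then {} else {hand_over y c}))"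

lemma finite_chains: "finite (chains m d n)"
  by (induction n) auto

lemma visited_forbid [simp]: "visited (forbid y c) = visited c"
  by (cases "(y, c)" rule: forbid.cases) (auto simp: visited_def)

lemma visited_Cons [simp]: "visited (g # c) = set (fst g) \<union> visited c"
  by (simp add: visited_def)

lemma visited_walk_on: "c \<noteq> [] \<Longrightarrow> visited (walk_on y c) = insert y (visited c)"
  by (cases "(y, c)" rule: walk_on.cases) auto

lemma visited_hand_over: "c \<noteq> [] \<Longrightarrow> visited (hand_over y c) = insert y (visited c)"
  by (cases "(y, c)" rule: hand_over.cases) auto

lemma map_fst_forbid: "map fst (forbid y c) = map fst c"
  by (cases "(y, c)" rule: forbid.cases) auto

text \<open>The head condition ensures that \<open>forbid\<close> will act on a segment that ends at
  the current site and is not yet restricted, as the weights require. Distinct starting sites give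
  independence; by closure under \<open>butlast\<close> a fresh site is never the parent of a
  visited one.\<close>

definition good_chain :: "nat \<Rightarrow> nat \<Rightarrow> chain \<Rightarrow> bool" where
  "good_chain m d c \<longleftrightarrow>
     (\<exists>xs c'. c = (xs, None) # c' \<and>
       (length xs = 1 \<longrightarrow> c' = [] \<or> (\<exists>zs c''. c' = (hd xs # zs, None) # c'' \<and> zs \<noteq> []))) \<and>
     (\<forall>g\<in>set c. fst g \<noteq> []) \<and> distinct (map (last \<circ> fst) c) \<and>
     visited c \<subseteq> D_verts m d \<and> butlast ` visited c \<subseteq> visited c \<and>
     prev c \<in> visited c \<and> (pos c \<noteq> [] \<longrightarrow> pos c \<in> nbrs m d (prev c)) \<and>
     (just_handed c \<longrightarrow> pos c \<noteq> [] \<and> butlast (prev c) \<noteq> pos c)"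

lemma good_chainE:
  assumes "good_chain m d c"
  obtains u xs c' where "c = (u # xs, None) # c'"
proof -
  obtain xs c' where c: "c = (xs, None) # c'"
    using assms unfolding good_chain_def by blast
  moreover have "xs \<noteq> []" using assms unfolding good_chain_def c by simp
  ultimately show thesis using that by (cases xs) auto
qed

lemma good_chain_initial: "good_chain m d [([D_root], None)]"
  by (simp add: good_chain_def visited_def pos_def just_handed_def D_root_def D_verts_def
      D_group_def free_product_def)

lemma good_chain_pos:
  assumes "good_chain m d c"
  shows "pos c \<in> visited c" "c \<noteq> []"
  using assms by (auto simp: good_chain_def pos_def)

lemma good_chain_extend:
  assumes m: "m \<ge> 2" and c: "good_chain m d c" and y: "y \<in> nbrs m d (pos c)"
    and head: "\<exists>xs c'. c2 = (xs, None) # c' \<and>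
       (length xs = 1 \<longrightarrow> c' = [] \<or> (\<exists>zs c''. c' = (hd xs # zs, None) # c'' \<and> zs \<noteq> []))"
    and segs: "\<forall>g\<in>set c2. fst g \<noteq> []" "distinct (map (last \<circ> fst) c2)"
    and vis: "visited c2 = insert y (visited c)" and prev: "prev c2 = pos c" and pos: "pos c2 = y"
    and jh: "just_handed c2 \<Longrightarrow> y \<notin> visited c"
  shows "good_chain m d c2"
proof -
  let ?u = "pos c"
  have cV: "visited c \<subseteq> D_verts m d" and cb: "butlast ` visited c \<subseteq> visited c"
    using c unfolding good_chain_def by blast+
  have u: "?u \<in> visited c" using good_chain_pos[OF c] by blast
  have closed: "butlast v \<in> visited c" if "v \<in> visited c" for v
    using cb that by blast
  have u': "butlast ?u \<in> visited c" "butlast (butlast ?u) \<in> visited c"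
    using closed u by blast+
  have "?u \<in> D_verts m d" using cV u by blast
  then have "y \<in> D_verts m d" using nbrs_subset[OF m] y by blast
  then have A: "visited c2 \<subseteq> D_verts m d" unfolding vis using cV by simp
  have "butlast y \<in> visited c" using butlast_nbrs[OF y] u u' by auto
  then have B: "butlast ` visited c2 \<subseteq> visited c2" unfolding vis using cb by auto
  have C: "prev c2 \<in> visited c2" "pos c2 \<noteq> [] \<longrightarrow> pos c2 \<in> nbrs m d (prev c2)"
    unfolding prev pos vis using u y by blast+
  \<comment> \<open>Closure under parents puts the root among the visited sites, so a fresh
    \<open>y\<close> is neither the root nor the parent of the current site.\<close>
  have root: "w \<in> visited c \<Longrightarrow> [] \<in> visited c" for w
  proof (induction w rule: rev_induct)
    case (snoc x w)
    then show ?case using closed[of "w @ [x]"] by simp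
  qed
  have D: "just_handed c2 \<longrightarrow> pos c2 \<noteq> [] \<and> butlast (prev c2) \<noteq> pos c2"
    using jh root[OF u] u'(1) prev pos by metis
  show ?thesis unfolding good_chain_def using head segs A B C D by blast
qed

lemma good_chain_walk_on:
  assumes m: "m \<ge> 2" and c: "good_chain m d c" and y: "y \<in> nbrs m d (pos c)"
  shows "good_chain m d (walk_on y c)"
proof -
  obtain u xs c' where c_eq: "c = (u # xs, None) # c'"
    using c by (rule good_chainE)
  have segs: "\<forall>g\<in>set c. fst g \<noteq> []" "distinct (map (last \<circ> fst) c)"
    using c unfolding good_chain_def by blast+
  show ?thesis
    by (rule good_chain_extend[OF m c y])
      (use segs in \<open>auto simp: c_eq pos_def just_handed_def visited_walk_on\<close>)
qed

lemma good_chain_hand_over: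
  assumes m: "m \<ge> 2" and c: "good_chain m d c" and y: "y \<in> nbrs m d (pos c)" "y \<notin> visited c"
  shows "good_chain m d (hand_over y c)"
proof -
  obtain u xs c' where c_eq: "c = (u # xs, None) # c'"
    using c by (rule good_chainE)
  define c'' where "c'' = (if xs = [] then forbid y c' else c')"
  have h: "hand_over y c = ([y], None) # (y # u # xs, None) # c''"
    by (simp add: c_eq c''_def)
  have fsts: "map fst c'' = map fst c'" by (simp add: c''_def map_fst_forbid)
  have segs: "\<forall>x\<in>set (map fst c). x \<noteq> []" "distinct (map last (map fst c))"
    using c unfolding good_chain_def by auto
  have "last x \<in> visited c" if "x \<in> set (map fst c)" for x
  proof -
    have "x \<in> fst ` set c" using that by simp
    then obtain g where "g \<in> set c" "x = fst g" by blast
    moreover have "x \<noteq> []" using segs(1) that by blast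
    ultimately show ?thesis unfolding visited_def using last_in_set by blast
  qed
  then have "y \<notin> last ` set (map fst c)" using y(2) by blast
  then have "y \<notin> set (map last (map fst c))" by (simp only: list.set_map not_False_eq_True)
  moreover have mf: "map fst (hand_over y c) = [y] # (y # u # xs) # map fst c'"
    using fsts by (simp add: h)
  ultimately have d: "distinct (map last (map fst (hand_over y c)))"
    unfolding mf using segs(2) by (simp add: c_eq)
  have ne: "\<forall>x\<in>set (map fst (hand_over y c)). x \<noteq> []"
    unfolding mf using segs(1) by (simp add: c_eq)
  show ?thesis
  proof (rule good_chain_extend[OF m c y(1)])
    show "\<forall>g\<in>set (hand_over y c). fst g \<noteq> []" using ne by simp
    show "distinct (map (last \<circ> fst) (hand_over y c))" using d by simp
    show "visited (hand_over y c) = insert y (visited c)"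
      by (rule visited_hand_over) (simp add: c_eq)
  qed (use y(2) in \<open>auto simp: h pos_def c_eq\<close>)
qed

lemma good_chains: "m \<ge> 2 \<Longrightarrow> c \<in> chains m d n \<Longrightarrow> good_chain m d c"
proof (induction n arbitrary: c)
  case 0
  then show ?case using good_chain_initial by simp
next
  case (Suc n)
  then show ?case
    using good_chain_walk_on[OF Suc.prems(1)] good_chain_hand_over[OF Suc.prems(1)]
    by (auto split: if_splits)
qed

section \<open>The expected number of chains\<close>

fun path_weight :: "('v \<Rightarrow> 'v \<Rightarrow> real) \<Rightarrow> 'v list \<Rightarrow> real" where
  "path_weight K (y # x # xs) = K x y * path_weight K (x # xs)"
| "path_weight K _ = 1"

context subcritical
begin

text \<open>Turns out to be the probability of \<open>seg_event\<close>: \<open>k\<close> sites need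
  a lifetime above \<open>k - 1\<close>, and a forbidden step removes the fraction that survives and
  moves to that site.\<close>

fun seg_weight :: "vertex list \<times> vertex option \<Rightarrow> real" where
  "seg_weight (xs, f) = p ^ (length xs - 1) * path_weight K xs *
     (case f of None \<Rightarrow> 1 | Some y \<Rightarrow> 1 - p * K (hd xs) y)"

definition weight :: "chain \<Rightarrow> real" where
  "weight c = prod_list (map seg_weight c)"

lemma path_weight_nonneg: "path_weight K xs \<ge> 0"
  using walk_kernel_bounds[OF m \<alpha> d] by (induction xs rule: induct_list012) auto

lemma weight_nonneg: "weight c \<ge> 0"
proof -
  have "seg_weight g \<ge> 0" for g
    using p path_weight_nonneg pK_bounds by (cases g) (auto split: option.splits)
  then show ?thesis unfolding weight_def by (induction c) auto
qed

lemma weight_walk_on: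
  assumes "good_chain m d c"
  shows "weight (walk_on y c) = weight c * (p * K (pos c) y)"
proof -
  obtain u xs c' where c_eq: "c = (u # xs, None) # c'"
    using assms by (rule good_chainE)
  show ?thesis by (simp add: c_eq weight_def pos_def)
qed

lemma weight_hand_over:
  assumes "good_chain m d c"
  shows "weight (hand_over y c) =
    weight c * (p * K (pos c) y) * handover_factor (pos c) (just_handed c) y"
proof -
  obtain u xs c' where c_eq: "c = (u # xs, None) # c'"
    using assms by (rule good_chainE)
  show ?thesis
  proof (cases "xs = [] \<and> c' \<noteq> []")
    case True
    then obtain zs c'' where "c' = (u # zs, None) # c''"
      using assms by (auto simp: good_chain_def c_eq)
    then show ?thesis using True
      by (simp add: c_eq weight_def pos_def just_handed_def handover_factor_def)
  next
    case False
    then show ?thesis by (auto simp: c_eq weight_def pos_def just_handed_def handover_factor_def)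
  qed
qed

definition chain_pot :: "chain \<Rightarrow> real" where
  "chain_pot c = pot (prev c) (pos c) (just_handed c) * remaining (visited c)"

text \<open>This is \<open>sum_step_term\<close> multiplied by the weight of the chain: an extension
  multiplies \<open>weight\<close> by exactly the factors in \<open>step_term\<close>, including the
  one imposed on the older segment at consecutive handovers.\<close>

lemma sum_weight_step:
  assumes c: "good_chain m d c"
  shows "(\<Sum>y\<in>nb (pos c). weight (walk_on y c) * chain_pot (walk_on y c) +
      (if y \<in> visited c then 0 else weight (hand_over y c) * chain_pot (hand_over y c)))
    \<le> \<theta> * (weight c * chain_pot c)"
proof -
  obtain u xs c' where c_eq: "c = (u # xs, None) # c'"
    using c by (rule good_chainE)
  let ?u = "pos c" and ?h = "just_handed c" and ?X = "visited c"
  have ne: "c \<noteq> []" using good_chain_pos c by blast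
  have walk: "chain_pot (walk_on y c) = pot ?u y False * remaining (insert y ?X)" for y
    using visited_walk_on[OF ne, of y] by (simp add: chain_pot_def c_eq pos_def just_handed_def)
  have hand: "chain_pot (hand_over y c) = pot ?u y True * remaining (insert y ?X)" for y
    using visited_hand_over[OF ne, of y] by (simp add: chain_pot_def c_eq pos_def just_handed_def)
  have "(\<Sum>y\<in>nb ?u. weight (walk_on y c) * chain_pot (walk_on y c) +
      (if y \<in> ?X then 0 else weight (hand_over y c) * chain_pot (hand_over y c))) =
    weight c * (\<Sum>y\<in>nb ?u. step_term ?u ?h ?X y * remaining (insert y ?X))"
    unfolding sum_distrib_left walk hand weight_walk_on[OF c] weight_hand_over[OF c]
    by (intro sum.cong refl) (simp add: step_term_def algebra_simps)
  also have "\<dots> \<le> weight c * (\<theta> * chain_pot c)"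
    unfolding chain_pot_def
    using c good_chain_pos[OF c] by (intro mult_left_mono sum_step_term weight_nonneg) (auto simp: good_chain_def)
  finally show ?thesis by (simp add: mult_ac)
qed

lemma sum_weight_chain_pot:
  "(\<Sum>c\<in>chains m d n. weight c * chain_pot c) \<le> \<theta> ^ n * 2 ^ card (level1 m d)"
proof (induction n)
  case 0
  have "weight [([D_root], None)] = 1" by (simp add: weight_def)
  moreover have "chain_pot [([D_root], None)] \<le> 1 * 2 ^ card (level1 m d)"
    unfolding chain_pot_def remaining_def
    using pot_nonneg by (intro mult_mono power_increasing card_mono) auto
  ultimately show ?case by simp
next
  case (Suc n)
  let ?f = "\<lambda>c. weight c * chain_pot c"
  have f: "0 \<le> ?f c" for c
    using weight_nonneg pot_nonneg by (simp add: chain_pot_def remaining_def)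
  let ?B = "\<lambda>c y. insert (walk_on y c) (if y \<in> visited c then {} else {hand_over y c})"
  have "sum ?f (chains m d (Suc n)) \<le>
      (\<Sum>c\<in>chains m d n. sum ?f (\<Union>y\<in>nb (pos c). ?B c y))"
    unfolding chains.simps by (intro sum_UNION_le f) (auto intro: finite_chains)
  also have "\<dots> \<le> (\<Sum>c\<in>chains m d n. \<Sum>y\<in>nb (pos c). sum ?f (?B c y))"
    by (intro sum_mono sum_UNION_le f) auto
  also have "\<dots> \<le> (\<Sum>c\<in>chains m d n. \<Sum>y\<in>nb (pos c).
      ?f (walk_on y c) + (if y \<in> visited c then 0 else ?f (hand_over y c)))"
  proof (intro sum_mono)
    fix c y
    show "sum ?f (?B c y) \<le>
        ?f (walk_on y c) + (if y \<in> visited c then 0 else ?f (hand_over y c))"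
      using f[of "hand_over y c"]
      by (cases "walk_on y c = hand_over y c") (auto simp: mult.commute)
  qed
  also have "\<dots> \<le> (\<Sum>c\<in>chains m d n. \<theta> * ?f c)"
    using good_chains[OF m] by (intro sum_mono sum_weight_step) auto
  also have "\<dots> \<le> \<theta> * (\<theta> ^ n * 2 ^ card (level1 m d))"
    unfolding sum_distrib_left[symmetric] using Suc.IH \<theta>_bounds by (intro mult_left_mono) auto
  finally show ?case by simp
qed

text \<open>Converts decay of the sum weighted by \<open>chain_pot\<close> into decay of the plain
  sum; every type has value at least 3/8.\<close>

lemma chain_pot_ge: "chain_pot c \<ge> 1 / 4"
proof -
  have "1 / 2 \<le> 1 - \<tau> + 2 * \<tau>\<^sup>2"
    using tau_le_half zero_le_power2[of \<tau>] by linarith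
  then have c: "3 / 4 * (1 / 2) \<le> \<gamma> * (1 - \<tau> + 2 * \<tau>\<^sup>2)"
    using gamma_bounds tau_le_half by (intro mult_mono) auto
  have "\<tau> * \<gamma> \<le> 1 / 2 * 1" "\<tau> * \<sigma> \<le> 1 / 2 * 1"
    using tau_nonneg tau_le_half gamma_bounds sigma_bounds by (intro mult_mono; simp)+
  then have "1 / 4 \<le> pot w u h" for w u h
    using c gamma_bounds by (auto simp: pot_def \<sigma>_def)
  moreover have "1 \<le> remaining X" for X by (simp add: remaining_def)
  ultimately have "1 / 4 * 1 \<le> chain_pot c"
    unfolding chain_pot_def using pot_nonneg by (intro mult_mono) auto
  then show ?thesis by simp
qed

lemma sum_weight:
  "(\<Sum>c\<in>chains m d n. weight c) \<le> 4 * 2 ^ card (level1 m d) * \<theta> ^ n"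
proof -
  have "weight c \<le> 4 * (weight c * chain_pot c)" for c
    using mult_left_mono[OF chain_pot_ge[of c] weight_nonneg[of c]] by simp
  then have "(\<Sum>c\<in>chains m d n. weight c) \<le> 4 * (\<Sum>c\<in>chains m d n. weight c * chain_pot c)"
    unfolding sum_distrib_left by (intro sum_mono)
  also have "\<dots> \<le> 4 * (\<theta> ^ n * 2 ^ card (level1 m d))"
    using sum_weight_chain_pot by simp
  finally show ?thesis by (simp add: mult_ac)
qed

end

section \<open>Probabilities\<close>

primrec follows :: "(nat \<Rightarrow> 'v) \<Rightarrow> 'v list \<Rightarrow> bool" where
  "follows X [] \<longleftrightarrow> True"
| "follows X (y # xs) \<longleftrightarrow> X (length xs) = y \<and> follows X xs"

lemma follows_iff: "follows X xs \<longleftrightarrow> (\<forall>i<length xs. X i = rev xs ! i)"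
  by (induction xs) (auto simp: nth_append less_Suc_eq)

lemma (in prob_space) prob_follows:
  assumes X: "markov_chain M K u X" and xs: "xs \<noteq> []" "last xs = u"
  shows "\<P>(\<omega> in M. follows (\<lambda>n. X n \<omega>) xs) = path_weight K xs"
  using xs
proof (induction xs rule: induct_list012)
  case (2 x)
  have "AE \<omega> in M. X 0 \<omega> = x" using X 2 by (simp add: markov_chain_def)
  moreover have [measurable]: "X 0 \<in> measurable M (count_space UNIV)"
    using X by (simp add: markov_chain_def)
  ultimately show ?case by (simp add: prob_Collect_eq_1)
next
  case (3 y x zs)
  let ?F = "\<lambda>\<omega>. follows (\<lambda>n. X n \<omega>) (x # zs)"
  have [measurable]: "X n \<in> measurable M (count_space UNIV)" for n
    using X by (simp add: markov_chain_def)
  have F: "?F \<omega> \<longleftrightarrow> (\<forall>i\<le>length zs. X i \<omega> = rev (x # zs) ! i)" for \<omega>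
    unfolding follows_iff by (simp add: less_Suc_eq_le)
  have IH: "\<P>(\<omega> in M. ?F \<omega>) = path_weight K (x # zs)"
    using 3 by simp
  show ?case
  proof (cases "\<P>(\<omega> in M. ?F \<omega>) > 0")
    case True
    have "rev (x # zs) ! length zs = x" by (simp add: nth_append)
    moreover have "\<forall>n z y. \<P>(\<omega> in M. \<forall>i\<le>n. X i \<omega> = z i) > 0 \<longrightarrow>
        \<P>(\<omega> in M. X (Suc n) \<omega> = y \<bar> \<forall>i\<le>n. X i \<omega> = z i) = K (z n) y"
      using X unfolding markov_chain_def by blast
    note this[rule_format, of "length zs" "\<lambda>i. rev (x # zs) ! i" y, folded F, OF True]
    ultimately have "\<P>(\<omega> in M. X (Suc (length zs)) \<omega> = y \<bar> ?F \<omega>) = K x y"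
      by simp
    then show ?thesis
      using True IH by (simp add: cond_prob_def field_simps)
  next
    \<comment> \<open>\<open>markov_chain\<close> says nothing about the step after a history of
      probability zero; here both sides vanish.\<close>
    case False
    then have z: "\<P>(\<omega> in M. ?F \<omega>) = 0" by (simp add: zero_less_measure_iff)
    have "\<P>(\<omega> in M. follows (\<lambda>n. X n \<omega>) (y # x # zs)) \<le> \<P>(\<omega> in M. ?F \<omega>)"
    proof (rule finite_measure_mono)
      show "{\<omega> \<in> space M. ?F \<omega>} \<in> events" unfolding F by measurable
    qed auto
    then show ?thesis using z IH by (simp add: measure_le_0_iff)
  qed
qed simp

fun seg_event :: "(vertex \<Rightarrow> nat \<Rightarrow> vertex) \<Rightarrow> (vertex \<Rightarrow> enat) \<Rightarrow>
    vertex list \<times> vertex option \<Rightarrow> bool" where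
  "seg_event s l (xs, f) \<longleftrightarrow>
     follows (s (last xs)) xs \<and> enat (length xs - 1) < l (last xs) \<and>
     (\<forall>y. f = Some y \<longrightarrow> \<not> (s (last xs) (length xs) = y \<and> enat (length xs) < l (last xs)))"

locale subcritical_frogs = frog_model M m d \<alpha> p S \<Xi> + subcritical m d \<alpha> p
  for M :: "'w measure" and m d \<alpha> p S \<Xi>
begin

lemma measurable_S: "u \<in> V \<Longrightarrow> S u n \<in> measurable M (count_space UNIV)"
  using walk by (simp add: markov_chain_def)

definition walk_sets :: "vertex \<Rightarrow> 'w set set" where
  "walk_sets u = {(\<lambda>\<omega> n. S u n \<omega>) -` A \<inter> space M | A. A \<in> sets (PiM UNIV (\<lambda>_. count_space UNIV))}"

definition life_sets :: "vertex \<Rightarrow> 'w set set" where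
  "life_sets u = {\<Xi> u -` B \<inter> space M | B. B \<in> sets (count_space UNIV)}"

abbreviation "both u \<equiv> sigma_sets (space M) (walk_sets u \<union> life_sets u)"

lemma walk_sets_follows: "{\<omega> \<in> space M. follows (\<lambda>n. S u n \<omega>) xs} \<in> walk_sets u"
proof -
  let ?P = "PiM UNIV (\<lambda>_::nat. count_space (UNIV :: vertex set))"
  let ?A = "{X \<in> space ?P. follows X xs}"
  have "?A \<in> sets ?P" unfolding follows_iff by measurable
  moreover have "{\<omega> \<in> space M. follows (\<lambda>n. S u n \<omega>) xs} = (\<lambda>\<omega> n. S u n \<omega>) -` ?A \<inter> space M"
    by (auto simp: space_PiM)
  ultimately show ?thesis unfolding walk_sets_def by blast
qed

lemma life_sets_gt: "{\<omega> \<in> space M. enat n < \<Xi> u \<omega>} \<in> life_sets u"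
  unfolding life_sets_def by (auto intro!: exI[of _ "{k. enat n < k}"])

lemma Int_stable_walk_sets: "Int_stable (walk_sets u)"
proof (rule Int_stableI)
  fix A B assume "A \<in> walk_sets u" "B \<in> walk_sets u"
  then obtain A' B' where
    "A = (\<lambda>\<omega> n. S u n \<omega>) -` A' \<inter> space M" "A' \<in> sets (PiM UNIV (\<lambda>_. count_space UNIV))"
    "B = (\<lambda>\<omega> n. S u n \<omega>) -` B' \<inter> space M" "B' \<in> sets (PiM UNIV (\<lambda>_. count_space UNIV))"
    unfolding walk_sets_def by blast
  then show "A \<inter> B \<in> walk_sets u" unfolding walk_sets_def
    by (auto intro!: exI[of _ "A' \<inter> B'"])
qed

lemma Int_stable_life_sets: "Int_stable (life_sets u)"
proof (rule Int_stableI)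
  fix A B assume "A \<in> life_sets u" "B \<in> life_sets u"
  then obtain A' B' where "A = \<Xi> u -` A' \<inter> space M" "B = \<Xi> u -` B' \<inter> space M"
    unfolding life_sets_def by blast
  then show "A \<inter> B \<in> life_sets u" unfolding life_sets_def
    by (auto intro!: exI[of _ "A' \<inter> B'"])
qed

lemma indep_all:
  "indep_sets (case_sum walk_sets life_sets) (V <+> V)"
proof -
  have "case_sum walk_sets life_sets = (\<lambda>k. case k of
            Inl u \<Rightarrow> {(\<lambda>\<omega> n. S u n \<omega>) -` A \<inter> space M | A. A \<in> sets (PiM UNIV (\<lambda>_. count_space UNIV))}
          | Inr u \<Rightarrow> {\<Xi> u -` B \<inter> space M | B. B \<in> sets (count_space UNIV)})"
    by (auto simp: fun_eq_iff walk_sets_def life_sets_def split: sum.splits)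
  then show ?thesis using independent by simp
qed

text \<open>Walk and lifetime of a vertex are merged because a segment event involves both, while
  different segments involve different vertices.\<close>

lemma indep_both: "indep_sets both V"
proof -
  have "indep_sets (\<lambda>u. sigma_sets (space M) (\<Union>i\<in>{Inl u, Inr u}. case_sum walk_sets life_sets i)) V"
  proof (rule indep_sets_collect_sigma)
    show "indep_sets (case_sum walk_sets life_sets) (\<Union>u\<in>V. {Inl u, Inr u})"
      by (rule indep_sets_mono_index[OF _ indep_all]) auto
    show "disjoint_family_on (\<lambda>u. {Inl u, Inr u}) V" by (auto simp: disjoint_family_on_def)
    show "Int_stable (case_sum walk_sets life_sets i)" if "j \<in> V" "i \<in> {Inl j, Inr j}" for i j
      using that Int_stable_walk_sets Int_stable_life_sets by auto
  qed
  then show ?thesis by simp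
qed

lemma prob_walk_life:
  assumes u: "u \<in> V" and A: "A \<in> walk_sets u" and B: "B \<in> life_sets u"
  shows "prob (A \<inter> B) = prob A * prob B"
proof -
  have "prob (\<Inter>j\<in>{Inl u, Inr u}. case_sum (\<lambda>_. A) (\<lambda>_. B) j) =
      (\<Prod>j\<in>{Inl u, Inr u}. prob (case_sum (\<lambda>_. A) (\<lambda>_. B) j))"
    using u A B by (intro indep_setsD[OF indep_all]) auto
  then show ?thesis by simp
qed

lemma seg_event_in_both: "{\<omega> \<in> space M. seg_event (\<lambda>u n. S u n \<omega>) (\<lambda>u. \<Xi> u \<omega>) (xs, f)} \<in> both (last xs)"
proof -
  let ?u = "last xs"
  interpret sigma_algebra "space M" "both ?u"
    by (rule sigma_algebra_sigma_sets)
       (auto simp: walk_sets_def life_sets_def)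
  let ?A = "\<lambda>xs. {\<omega> \<in> space M. follows (\<lambda>n. S ?u n \<omega>) xs}"
  let ?B = "\<lambda>n. {\<omega> \<in> space M. enat n < \<Xi> ?u \<omega>}"
  have A: "?A xs \<in> both ?u" and B: "?B n \<in> both ?u" for xs n
    using walk_sets_follows life_sets_gt by (auto intro: sigma_sets.Basic)
  have "{\<omega> \<in> space M. seg_event (\<lambda>u n. S u n \<omega>) (\<lambda>u. \<Xi> u \<omega>) (xs, f)} =
    (case f of None \<Rightarrow> ?A xs \<inter> ?B (length xs - 1)
     | Some y \<Rightarrow> ?A xs \<inter> ?B (length xs - 1) - ?A (y # xs) \<inter> ?B (length xs))"
    by (auto split: option.splits)
  also have "\<dots> \<in> both ?u"
  proof (cases f)
    case None
    then show ?thesis using A B by (simp only: option.case) (intro Int)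
  next
    case (Some y)
    then show ?thesis using A B by (simp only: option.case) (intro Diff Int)
  qed
  finally show ?thesis .
qed

lemma prob_seg_event:
  assumes xs: "xs \<noteq> []" "last xs \<in> V"
  shows "\<P>(\<omega> in M. seg_event (\<lambda>u n. S u n \<omega>) (\<lambda>u. \<Xi> u \<omega>) (xs, f)) = seg_weight (xs, f)"
proof -
  let ?u = "last xs"
  let ?A = "\<lambda>xs. {\<omega> \<in> space M. follows (\<lambda>n. S ?u n \<omega>) xs}"
  let ?B = "\<lambda>n. {\<omega> \<in> space M. enat n < \<Xi> ?u \<omega>}"
  have [measurable]: "\<Xi> ?u \<in> measurable M (count_space UNIV)" "S ?u n \<in> measurable M (count_space UNIV)" for n
    using lifetime_measurable measurable_S xs by auto
  have [measurable]: "?A ys \<in> events" "?B n \<in> events" for ys n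
    unfolding follows_iff by measurable
  have P: "prob (?A ys \<inter> ?B n) = path_weight K ys * p ^ n" if "ys \<noteq> []" "last ys = ?u" for ys n
    using prob_walk_life[OF xs(2) walk_sets_follows life_sets_gt, of ys n]
      prob_follows[OF walk[OF xs(2)] that] lifetime[OF xs(2)] by simp
  show ?thesis
  proof (cases f)
    case None
    have "{\<omega> \<in> space M. seg_event (\<lambda>u n. S u n \<omega>) (\<lambda>u. \<Xi> u \<omega>) (xs, f)} = ?A xs \<inter> ?B (length xs - 1)"
      using None by auto
    then show ?thesis using P[of xs] xs None by simp
  next
    case (Some y)
    obtain x zs where eq: "xs = x # zs" using xs by (cases xs) auto
    have "{\<omega> \<in> space M. seg_event (\<lambda>u n. S u n \<omega>) (\<lambda>u. \<Xi> u \<omega>) (xs, f)} =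
        ?A xs \<inter> ?B (length xs - 1) - ?A (y # xs) \<inter> ?B (length xs)"
      using Some by auto
    \<comment> \<open>The forbidden continuation is a subevent; subtracting its probability produces
      the factor \<open>1 - p * K (hd xs) y\<close>.\<close>
    moreover have "prob (?A xs \<inter> ?B (length xs - 1) - ?A (y # xs) \<inter> ?B (length xs)) = prob (?A xs \<inter> ?B (length xs - 1)) - prob (?A (y # xs) \<inter> ?B (length xs))"
    proof (rule finite_measure_Diff)
      show "?A (y # xs) \<inter> ?B (length xs) \<subseteq> ?A xs \<inter> ?B (length xs - 1)"
        by (auto intro: le_less_trans[rotated])
    qed auto
    moreover have "prob (?A xs \<inter> ?B (length xs - 1)) = path_weight K xs * p ^ (length xs - 1)"
      "prob (?A (y # xs) \<inter> ?B (length xs)) = path_weight K (y # xs) * p ^ length xs"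
      by (rule P; use xs in simp)+
    ultimately show ?thesis using Some by (simp add: eq algebra_simps)
  qed
qed

definition chain_event :: "(vertex list \<times> vertex option) list \<Rightarrow> 'w set" where
  "chain_event c = {\<omega> \<in> space M. \<forall>g\<in>set c. seg_event (\<lambda>u n. S u n \<omega>) (\<lambda>u. \<Xi> u \<omega>) g}"

lemma prob_chain_event:
  assumes c: "c \<noteq> []" "\<forall>g\<in>set c. fst g \<noteq> [] \<and> last (fst g) \<in> V"
    and dist: "distinct (map (last \<circ> fst) c)"
  shows "chain_event c \<in> events" "prob (chain_event c) = prod_list (map seg_weight c)"
proof -
  let ?E = "\<lambda>g. {\<omega> \<in> space M. seg_event (\<lambda>u n. S u n \<omega>) (\<lambda>u. \<Xi> u \<omega>) g}"
  let ?l = "last \<circ> fst"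
  have inj: "inj_on ?l (set c)" using dist by (simp add: distinct_map)
  \<comment> \<open>Independence is indexed by vertices, so each segment event is reindexed by the
    vertex whose frog it describes.\<close>
  define E where "E u = ?E (the_inv_into (set c) ?l u)" for u
  have E: "E (?l g) = ?E g" if "g \<in> set c" for g
    using that inj unfolding E_def by (simp only: the_inv_into_f_f)
  have both: "E u \<in> both u" if u: "u \<in> ?l ` set c" for u
  proof -
    obtain g where g: "g \<in> set c" "u = ?l g" using u by blast
    show ?thesis using seg_event_in_both[of "fst g" "snd g"] E[OF g(1)] by (simp add: g(2))
  qed
  have sub: "?l ` set c \<subseteq> V" using c(2) by auto
  have eq: "chain_event c = (\<Inter>u\<in>?l ` set c. E u)"
  proof -
    have "(\<Inter>u\<in>?l ` set c. E u) = (\<Inter>g\<in>set c. ?E g)" using E by simp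
    also have "\<dots> = chain_event c" using c(1) by (cases c) (auto simp: chain_event_def)
    finally show ?thesis ..
  qed
  have "both u \<subseteq> events" if "u \<in> V" for u
    using indep_both that by (simp add: indep_sets_def)
  then have "E u \<in> events" if "u \<in> ?l ` set c" for u using both that sub by blast
  then show "chain_event c \<in> events" unfolding eq using c(1) by (intro sets.finite_INT) auto
  have "prob (\<Inter>u\<in>?l ` set c. E u) = (\<Prod>u\<in>?l ` set c. prob (E u))"
    using c(1) sub both by (intro indep_setsD[OF indep_both]) auto
  also have "\<dots> = (\<Prod>g\<in>set c. prob (?E g))"
    unfolding prod.reindex[OF inj] by (intro prod.cong) (simp_all add: E[unfolded o_apply])
  also have "\<dots> = (\<Prod>g\<in>set c. seg_weight g)"
  proof (rule prod.cong)
    fix g assume "g \<in> set c"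
    then show "prob (?E g) = seg_weight g"
      using prob_seg_event[of "fst g" "snd g"] c(2) by simp
  qed simp
  also have "\<dots> = prod_list (map seg_weight c)"
    using dist by (intro prod.distinct_set_conv_list) (simp add: distinct_map)
  finally show "prob (chain_event c) = prod_list (map seg_weight c)" unfolding eq .
qed

end

section \<open>Activation\<close>

context
  fixes V :: "vertex set" and s :: "vertex \<Rightarrow> nat \<Rightarrow> vertex" and l :: "vertex \<Rightarrow> enat"
begin

text \<open>The activation time, freed from the moment of observation; \<open>woken_iff\<close>
  recovers \<open>woken\<close>.\<close>

definition wakes :: "vertex \<Rightarrow> nat \<Rightarrow> bool" where
  "wakes u k \<longleftrightarrow> woken V s l k u = Some k"

lemma woken_mono:
  assumes "woken V s l t u = Some k" "t \<le> t'"
  shows "woken V s l t' u = Some k"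
  using assms(2,1) by (induction rule: dec_induct) auto

lemma woken_iff: "woken V s l t u = Some k \<longleftrightarrow> wakes u k \<and> k \<le> t"
proof
  show "woken V s l t u = Some k" if "wakes u k \<and> k \<le> t"
    using that woken_mono unfolding wakes_def by blast
  show "wakes u k \<and> k \<le> t" if "woken V s l t u = Some k"
    using that
  proof (induction t)
    case 0
    then show ?case by (auto simp: wakes_def split: if_splits)
  next
    case (Suc t)
    show ?case
    proof (cases "woken V s l t u")
      case None
      then have "k = Suc t" using Suc.prems by (auto split: if_splits)
      then show ?thesis using Suc.prems by (simp only: wakes_def order_refl simp_thms)
    next
      case (Some k')
      then show ?thesis using Suc by auto
    qed
  qed
qed

lemma wakes_unique: "wakes u k \<Longrightarrow> wakes u k' \<Longrightarrow> k = k'"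
  using woken_iff[of "max k k'" u k] woken_iff[of "max k k'" u k'] by simp

lemma wakes_0: "wakes u 0 \<longleftrightarrow> u = D_root"
  by (simp add: wakes_def)

lemma wakes_Suc:
  assumes "wakes v (Suc t)"
  shows "v \<in> V" "\<exists>u k. k \<le> t \<and> wakes u k \<and> enat (Suc t - k) < l u \<and> s u (Suc t - k) = v"
proof -
  have "woken V s l t v = None"
  proof (cases "woken V s l t v")
    case (Some k)
    then have "wakes v k" "k \<le> t" using woken_iff by auto
    then show ?thesis using wakes_unique[OF assms, of k] by simp
  qed
  then have "v \<in> V \<and> (\<exists>u k. woken V s l t u = Some k \<and> enat (Suc t - k) < l u \<and> s u (Suc t - k) = v)"
    using assms by (auto simp: wakes_def split: if_splits)
  then show "v \<in> V" "\<exists>u k. k \<le> t \<and> wakes u k \<and> enat (Suc t - k) < l u \<and> s u (Suc t - k) = v"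
    unfolding woken_iff by blast+
qed

lemma wakes_visited:
  assumes "wakes u k" "enat n < l u" "s u n \<in> V" "s u 0 = u"
  shows "\<exists>j\<le>k + n. wakes (s u n) j"
proof (cases n)
  case 0
  then show ?thesis using assms by auto
next
  case (Suc i)
  have u: "woken V s l (k + i) u = Some k" using assms(1) woken_iff by simp
  have k: "Suc (k + i) - k = n" using Suc by simp
  have "\<exists>j. woken V s l (Suc (k + i)) (s u n) = Some j"
  proof (cases "woken V s l (k + i) (s u n)")
    case None
    have "\<exists>v j. woken V s l (k + i) v = Some j \<and> enat (Suc (k + i) - j) < l v \<and>
        s v (Suc (k + i) - j) = s u n"
      using u k assms(2) by metis
    then show ?thesis using None assms(3) by simp
  qed simp
  then show ?thesis unfolding woken_iff using Suc by auto
qed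

definition regular :: "nat \<Rightarrow> nat \<Rightarrow> bool" where
  "regular m d \<longleftrightarrow> (\<forall>u\<in>V. s u 0 = u \<and> 0 < l u \<and> (\<forall>n. s u (Suc n) \<in> nbrs m d (s u n)))"

text \<open>A segment with \<open>n\<close> steps has \<open>Suc n\<close> entries, so the equation
  says that the older frog, awake since time \<open>j\<close>, reaches the head of \<open>zs\<close>
  at time \<open>k\<close>. A forbidden step would then fall at time \<open>Suc k\<close>.\<close>

definition earlier :: "chain \<Rightarrow> nat \<Rightarrow> bool" where
  "earlier c k \<longleftrightarrow> tl c = [] \<or> (\<exists>zs f c'. tl c = (zs, f) # c' \<and>
     (\<exists>j<k. wakes (last zs) j \<and> j + length zs = Suc k))"

text \<open>All sites of the chain being awake by time \<open>t\<close>, a site that wakes up at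
  \<open>Suc t\<close> is fresh for it.\<close>

definition realized :: "chain \<Rightarrow> nat \<Rightarrow> bool" where
  "realized c t \<longleftrightarrow> (\<forall>g\<in>set c. seg_event s l g) \<and> (\<forall>v\<in>visited c. \<exists>j\<le>t. wakes v j)"

context
  fixes m d :: nat
  assumes m: "m \<ge> 2" and V: "V = D_verts m d" and reg: "regular m d"
begin

lemma in_V:
  assumes "u \<in> V"
  shows "s u n \<in> V"
proof (induction n)
  case 0
  then show ?case using reg assms by (simp add: regular_def)
next
  case (Suc n)
  have "s u (Suc n) \<in> nbrs m d (s u n)" using reg assms by (simp add: regular_def)
  then show ?case using nbrs_subset[OF m, of "s u n" d] Suc unfolding V by blast
qed

lemma wakes_in_V: "wakes u k \<Longrightarrow> u \<in> V"
proof (cases k)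
  case 0
  have "D_root \<in> V" by (simp add: V D_root_def D_verts_iff[OF m])
  then show "wakes u k \<Longrightarrow> u \<in> V" using 0 wakes_0 by simp
qed (use wakes_Suc(1) in blast)

lemma walk_chain:
  assumes u: "wakes u k" and c: "([u], None) # c \<in> chains m d k" "realized (([u], None) # c) k"
    and n: "enat n < l u"
  shows "\<exists>xs. (xs, None) # c \<in> chains m d (k + n) \<and> realized ((xs, None) # c) (k + n) \<and>
    length xs = Suc n \<and> hd xs = s u n \<and> last xs = u \<and> follows (s u) xs"
  using n
proof (induction n)
  case 0
  have "s u 0 = u" using reg wakes_in_V[OF u] by (simp add: regular_def)
  then show ?case using c by (intro exI[of _ "[u]"]) simp
next
  case (Suc n)
  have uV: "u \<in> V" using wakes_in_V[OF u] .
  have "enat n < l u" using Suc.prems by (meson enat_ord_simps(2) lessI less_trans)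
  then obtain xs where xs: "(xs, None) # c \<in> chains m d (k + n)" "realized ((xs, None) # c) (k + n)"
    "length xs = Suc n" "hd xs = s u n" "last xs = u" "follows (s u) xs"
    using Suc.IH by blast
  let ?y = "s u (Suc n)"
  have "?y \<in> nbrs m d (s u n)" using reg uV by (simp add: regular_def)
  then have "walk_on ?y ((xs, None) # c) \<in> chains m d (Suc (k + n))"
    using xs(1,4) by (auto simp: pos_def intro!: bexI[of _ "(xs, None) # c"] bexI[of _ ?y])
  moreover have "realized ((?y # xs, None) # c) (k + Suc n)"
  proof -
    have "\<exists>j\<le>k + Suc n. wakes ?y j"
      using wakes_visited[OF u Suc.prems in_V[OF uV]] reg uV by (simp add: regular_def)
    moreover have "\<forall>v\<in>visited ((xs, None) # c). \<exists>j\<le>k + Suc n. wakes v j"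
      using xs(2) unfolding realized_def by (metis add_Suc_right le_SucI)
    ultimately show ?thesis
      using xs Suc.prems unfolding realized_def by auto
  qed
  ultimately show ?case
    using xs by (intro exI[of _ "?y # xs"]) auto
qed

lemma wakes_chain:
  "wakes v k \<Longrightarrow> \<exists>c. ([v], None) # c \<in> chains m d k \<and> realized (([v], None) # c) k \<and>
    earlier (([v], None) # c) k"
proof (induction k arbitrary: v rule: less_induct)
  case (less k)
  have vV: "v \<in> V" using wakes_in_V less.prems .
  then have v: "s v 0 = v" "0 < l v" using reg by (auto simp: regular_def)
  show ?case
  proof (cases k)
    case 0
    then have "v = D_root" using less.prems wakes_0 by simp
    then show ?thesis using less.prems v 0
      by (intro exI[of _ "[]"]) (auto simp: realized_def earlier_def visited_def zero_enat_def)
  next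
    case (Suc t)
    let ?P = "\<lambda>j. j \<le> t \<and> (\<exists>u. wakes u j \<and> enat (Suc t - j) < l u \<and> s u (Suc t - j) = v)"
    \<comment> \<open>Of all frogs that reach \<open>v\<close> at its activation time, one that woke
      up first is held responsible; its minimality yields the forbidden step.\<close>
    define j where "j = (LEAST j. ?P j)"
    have "\<exists>j. ?P j" using wakes_Suc(2) less.prems Suc by blast
    then have Pj: "?P j" unfolding j_def by (rule LeastI_ex)
    have min: "\<not> ?P i" if "i < j" for i using that not_less_Least unfolding j_def by blast
    from Pj obtain u n where u: "wakes u j" "enat (Suc n) < l u" "s u (Suc n) = v" and n: "t = j + n"
      by (metis Suc_diff_le le_Suc_ex add_diff_cancel_left')
    have "j < k" using n Suc by simp
    then obtain c where c: "([u], None) # c \<in> chains m d j" "realized (([u], None) # c) j"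
      "earlier (([u], None) # c) j" using less.IH u(1) by blast
    have "enat n < l u" using u(2) by (meson enat_ord_simps(2) lessI less_trans)
    then obtain xs where xs: "(xs, None) # c \<in> chains m d t" "realized ((xs, None) # c) t"
      "length xs = Suc n" "hd xs = s u n" "last xs = u" "follows (s u) xs"
      using walk_chain[OF u(1) c(1,2)] n by blast
    let ?c = "(xs, None) # c"
    have uV: "u \<in> V" using wakes_in_V u(1) .
    have "v \<in> nbrs m d (pos ?c)" using reg uV u(3) xs(4) by (auto simp: regular_def pos_def)
    moreover have new: "v \<notin> visited ?c"
    proof
      assume "v \<in> visited ?c"
      then obtain i where "i \<le> t" "wakes v i" using xs(2) unfolding realized_def by blast
      then show False using wakes_unique[OF less.prems] Suc by fastforce
    qed
    ultimately have chain: "hand_over v ?c \<in> chains m d k"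
      using xs(1) unfolding Suc by (auto intro!: bexI[of _ ?c] bexI[of _ v])
    define c2 where "c2 = (if length xs = 1 then forbid v c else c)"
    have eq: "hand_over v ?c = ([v], None) # (v # xs, None) # c2" by (simp add: c2_def)
    have seg: "seg_event s l g" if "g \<in> set c2" for g
    proof (cases "length xs = 1 \<and> c \<noteq> []")
      case True
      then have n0: "n = 0" "j = t" using xs(3) n by auto
      obtain zs f c' i where c': "c = (zs, f) # c'" and i: "i < j" "wakes (last zs) i" "i + length zs = Suc j"
        using True c(3) by (auto simp: earlier_def)
      \<comment> \<open>Otherwise the older frog would reach \<open>v\<close> at time
        \<open>Suc t\<close> too, having woken up before \<open>u\<close>, against the minimality of
        \<open>j\<close>.\<close>
      have "\<not> (s (last zs) (length zs) = v \<and> enat (length zs) < l (last zs))"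
      proof
        assume *: "s (last zs) (length zs) = v \<and> enat (length zs) < l (last zs)"
        have "Suc t - i = length zs" using i n0 by simp
        then have "?P i" using * i n0 by (metis less_imp_le)
        then show False using min i by blast
      qed
      then show ?thesis using that c(2) True by (auto simp: c2_def c' realized_def)
    next
      case False
      then have "c2 = c" by (auto simp: c2_def)
      then show ?thesis using that xs(2) by (simp add: realized_def)
    qed
    have "realized (hand_over v ?c) k"
      unfolding realized_def
    proof
      show "\<forall>g\<in>set (hand_over v ?c). seg_event s l g"
        unfolding eq using seg v u(2,3) xs(3,5,6) by (auto simp: zero_enat_def)
      show "\<forall>w\<in>visited (hand_over v ?c). \<exists>j\<le>k. wakes w j"
      proof -
        have "\<forall>w\<in>visited ?c. \<exists>j\<le>k. wakes w j"
          using xs(2) Suc unfolding realized_def by (meson le_SucI)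
        then show ?thesis using less.prems by (subst visited_hand_over) auto
      qed
    qed
    moreover have "earlier (hand_over v ?c) k"
      unfolding eq earlier_def using u(1) xs(3,5) n Suc
      by (auto intro!: exI[of _ j])
    ultimately show ?thesis using chain unfolding eq by blast
  qed
qed

lemma survives_chain:
  assumes "survives V s l"
  shows "\<exists>c\<in>chains m d t. \<forall>g\<in>set c. seg_event s l g"
proof -
  obtain u k where "woken V s l t u = Some k" "enat (t - k) < l u"
    using assms by (fastforce simp: survives_def active_at_def)
  then have u: "wakes u k" "k \<le> t" "enat (t - k) < l u" by (auto simp: woken_iff)
  obtain c where c: "([u], None) # c \<in> chains m d k" "realized (([u], None) # c) k"
    using wakes_chain[OF u(1)] by blast
  obtain xs where xs: "(xs, None) # c \<in> chains m d (k + (t - k))"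
    "realized ((xs, None) # c) (k + (t - k))"
    using walk_chain[OF u(1) c u(3)] by blast
  have "(xs, None) # c \<in> chains m d t" using xs(1) u(2) by simp
  then show ?thesis using xs(2) unfolding realized_def by blast
qed

end

end

section \<open>Almost sure extinction\<close>

context subcritical_frogs
begin

text \<open>A step outside \<open>nbrs\<close> has kernel value 0, hence would complete a finite
  path of weight 0. Such a path is followed with probability 0, and there are only countably many
  finite paths.\<close>

lemma AE_regular: "AE \<omega> in M. regular V (\<lambda>u n. S u n \<omega>) (\<lambda>u. \<Xi> u \<omega>) m d"
proof -
  have V: "countable V" by (rule countableI_type)
  have start: "AE \<omega> in M. S u 0 \<omega> = u" if "u \<in> V" for u
    using walk[OF that] by (simp add: markov_chain_def)
  have life: "AE \<omega> in M. 0 < \<Xi> u \<omega>" if "u \<in> V" for u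
  proof -
    have [measurable]: "\<Xi> u \<in> measurable M (count_space UNIV)" using lifetime_measurable that .
    have "\<P>(\<omega> in M. 0 < \<Xi> u \<omega>) = 1" using lifetime[OF that, of 0] by (simp add: zero_enat_def)
    then show ?thesis by (simp add: prob_Collect_eq_1)
  qed
  have pos: "AE \<omega> in M. follows (\<lambda>n. S u n \<omega>) xs \<longrightarrow> path_weight K xs \<noteq> 0"
    if "u \<in> V" "xs \<noteq> []" "last xs = u" for u xs
  proof (cases "path_weight K xs = 0")
    case True
    have [measurable]: "S u n \<in> measurable M (count_space UNIV)" for n using measurable_S that by blast
    have "{\<omega> \<in> space M. follows (\<lambda>n. S u n \<omega>) xs} \<in> events" unfolding follows_iff by measurable
    then have "AE \<omega> in M. \<not> follows (\<lambda>n. S u n \<omega>) xs"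
      using prob_follows[OF walk[OF that(1)] that(2,3)] True by (simp add: prob_Collect_eq_0)
    then show ?thesis by eventually_elim simp
  qed simp
  have "AE \<omega> in M. \<forall>u\<in>V. S u 0 \<omega> = u \<and> 0 < \<Xi> u \<omega> \<and>
      (\<forall>xs. xs \<noteq> [] \<and> last xs = u \<longrightarrow> follows (\<lambda>n. S u n \<omega>) xs \<longrightarrow> path_weight K xs \<noteq> 0)"
    using start life pos by (auto simp: AE_ball_countable AE_all_countable V)
  then show ?thesis
  proof (rule AE_mp, intro AE_I2 impI)
    fix \<omega>
    assume *: "\<forall>u\<in>V. S u 0 \<omega> = u \<and> 0 < \<Xi> u \<omega> \<and>
      (\<forall>xs. xs \<noteq> [] \<and> last xs = u \<longrightarrow> follows (\<lambda>n. S u n \<omega>) xs \<longrightarrow> path_weight K xs \<noteq> 0)"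
    have "S u n \<omega> \<in> V \<and> S u (Suc n) \<omega> \<in> nb (S u n \<omega>)" if u: "u \<in> V" for u n
    proof -
      have step: "S u (Suc n) \<omega> \<in> nb (S u n \<omega>)" if "S u n \<omega> \<in> V" for n
      proof -
        let ?xs = "rev (map (\<lambda>i. S u i \<omega>) [0..<Suc (Suc n)])"
        have "last ?xs = u" using * u by (simp add: last_rev hd_map del: upt_Suc)
        moreover have "follows (\<lambda>n. S u n \<omega>) ?xs" unfolding follows_iff by (simp del: upt_Suc)
        moreover have "?xs \<noteq> []" by simp
        ultimately have "path_weight K ?xs \<noteq> 0" using * u by blast
        then have "K (S u n \<omega>) (S u (Suc n) \<omega>) \<noteq> 0" by simp
        then show ?thesis using walk_kernel_pos_imp_nbrs[OF m that] by blast
      qed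
      have "S u n \<omega> \<in> V"
      proof (induction n)
        case 0
        then show ?case using * u by simp
      next
        case (Suc n)
        then show ?case using step nbrs_subset[OF m] by blast
      qed
      then show ?thesis using step by blast
    qed
    then show "regular V (\<lambda>u n. S u n \<omega>) (\<lambda>u. \<Xi> u \<omega>) m d"
      using * by (simp add: regular_def)
  qed
qed

lemma AE_dies_out: "AE \<omega> in M. dies_out V (\<lambda>u n. S u n \<omega>) (\<lambda>u. \<Xi> u \<omega>)"
proof -
  define A where "A n = (\<Union>c\<in>chains m d n. chain_event c)" for n
  have good: "c \<noteq> []" "\<forall>g\<in>set c. fst g \<noteq> [] \<and> last (fst g) \<in> V" "distinct (map (last \<circ> fst) c)"
    if "c \<in> chains m d n" for c n
  proof -
    have g: "good_chain m d c" using good_chains[OF m that] .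
    show "c \<noteq> []" using good_chain_pos[OF g] by blast
    show "\<forall>g\<in>set c. fst g \<noteq> [] \<and> last (fst g) \<in> V"
      using g unfolding good_chain_def visited_def by (meson UN_I last_in_set subsetD)
    show "distinct (map (last \<circ> fst) c)" using g unfolding good_chain_def by blast
  qed
  have A: "A n \<in> events" for n
    unfolding A_def using finite_chains prob_chain_event(1)[OF good] by blast
  have "prob (A n) \<le> 4 * 2 ^ card (level1 m d) * \<theta> ^ n" for n
  proof -
    have "prob (A n) \<le> (\<Sum>c\<in>chains m d n. prob (chain_event c))"
      unfolding A_def using finite_chains prob_chain_event(1)[OF good]
      by (intro finite_measure_subadditive_finite) auto
    also have "\<dots> = (\<Sum>c\<in>chains m d n. weight c)"
      using prob_chain_event(2)[OF good] by (intro sum.cong) (auto simp: weight_def)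
    also have "\<dots> \<le> 4 * 2 ^ card (level1 m d) * \<theta> ^ n" by (rule sum_weight)
    finally show ?thesis .
  qed
  \<comment> \<open>Up to a null set, survival is contained in every \<open>A n\<close>; it suffices
    that their intersection is null.\<close>
  then have le: "prob (\<Inter>n. A n) \<le> 4 * 2 ^ card (level1 m d) * \<theta> ^ n" for n
    using finite_measure_mono[of "\<Inter>n. A n" "A n"] A by (meson INF_lower UNIV_I order_trans)
  have "(\<lambda>n. 4 * 2 ^ card (level1 m d) * \<theta> ^ n) \<longlonglongrightarrow> 4 * 2 ^ card (level1 m d) * 0"
    using \<theta>_bounds by (intro tendsto_mult tendsto_const LIMSEQ_realpow_zero) auto
  from LIMSEQ_le_const[OF this] have "prob (\<Inter>n. A n) \<le> 4 * 2 ^ card (level1 m d) * 0"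
    using le by blast
  then have "prob (\<Inter>n. A n) = 0" by (simp add: measure_le_0_iff)
  moreover have "(\<Inter>n. A n) \<in> events" using A by blast
  ultimately have "AE \<omega> in M. \<omega> \<notin> (\<Inter>n. A n)"
    by (intro AE_not_in) (simp add: null_sets_def emeasure_eq_measure)
  with AE_regular AE_space show ?thesis
  proof eventually_elim
    case (elim \<omega>)
    show ?case unfolding dies_out_def
    proof
      assume "survives V (\<lambda>u n. S u n \<omega>) (\<lambda>u. \<Xi> u \<omega>)"
      then have "\<omega> \<in> A n" for n
        using survives_chain[OF m refl elim(1), of n] elim(2) by (auto simp: A_def chain_event_def)
      then show False using elim(3) by blast
    qed
  qed
qed

end

theorem theorem3p1:
  fixes m d :: nat and \<alpha> p :: real
    and M :: "'w measure"
    and S :: "vertex \<Rightarrow> nat \<Rightarrow> 'w \<Rightarrow> vertex"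
    and \<Xi> :: "vertex \<Rightarrow> 'w \<Rightarrow> enat"
  assumes "m \<ge> 2" and "d \<ge> 2"
    and "\<alpha> \<in> {0..1}" and "p \<in> {0..1}"
    and "psi m d \<alpha> p < 1"
    and "frog_model M m d \<alpha> p S \<Xi>"
  shows "AE \<omega> in M. dies_out (D_verts m d) (\<lambda>u n. S u n \<omega>) (\<lambda>u. \<Xi> u \<omega>)"
proof -
  interpret frog_model M m d \<alpha> p S \<Xi> by fact
  interpret subcritical_frogs M m d \<alpha> p S \<Xi>
    by unfold_locales (use assms in auto)
  show ?thesis by (rule AE_dies_out)
qed

end
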